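(* Let $\mathbf X$ be a stationary and isotropic pairwise interaction point process in $\mathbb R^d$ with Papangelou conditional intensity $$\lambda(u,\mathbf x)=\beta^\star\exp\Big(-\sum_{v\in\mathbf x\setminus u}\gamma(\|v-u\|)\Big),\qquad u\in\mathbb R^d,\ \mathbf x\in N_{lf},$$ where $\gamma(t)=0$ whenever $t>R$. (i) If the kernel $K_1$ and bandwidths $(b_n)$ satisfy Condition $K(1,1)$ (see context), then for all $r\in(0,R]$, $$\lim_{n\to\infty}E\widehat R_n(r)=\beta^{\star 2}J(r)\exp(-\gamma(r)).$$ (ii) Let $\alpha\ge1$ be an integer and $r\in(0,R]$. If Condition $K(1,\alpha)$ is satisfied and the function $t\mapsto\exp(-\gamma(t))J(t)$ has bounded and continuous derivatives of order $\alpha$ in $(r-\delta,r+\delta)$ for some $\delta>0$, then $$E\widehat R_n(r)=\beta^{\star 2}J(r)\exp(-\gamma(r))+\mathcal O(b_n^\alpha)\qquad\text{as }n\to\infty.$$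
   Context: $N_{lf}$ is the space of locally finite point configurations in $\mathbb R^d$; $\|\cdot\|$ is the Euclidean norm; $|W|$ is the Lebesgue measure of a bounded Borel set $W$; $o$ is the origin; $\sigma_d=2\pi^{d/2}/\Gamma(d/2)$ is the surface measure of the unit sphere $\mathbb S^{d-1}$. Integrals $\int_{\mathbb S^{d-1}}\cdots\,\mathrm dv$ are with respect to the normalized (probability) uniform measure on the sphere, so that $\int_{\mathbb R^d}f(u)\,\mathrm du=\int_0^\infty\int_{\mathbb S^{d-1}}f(tz)\,t^{d-1}\sigma_d\,\mathrm dt\,\mathrm dz$. A point process $\mathbf X$ has Papangelou conditional intensity $\lambda$ if $E\sum_{u\in\mathbf X}h(u,\mathbf X\setminus\{u\})=\int_{\mathbb R^d}E[h(u,\mathbf X)\lambda(u,\mathbf X)]\,\mathrm du$ for all non-negative measurable $h$. Here $\beta^\star>0$, $0<R<\infty$ is the interaction range, and it is assumed throughout that $\gamma(t)>0$ for $t\le R$. Put $d(u,\mathbf x)=\inf_{v\in\mathbf x}\|v-u\|$, $\widetilde h(u,\mathbf x)=\mathbf 1(d(u,\mathbf x)>R)$, $\widetilde F(o,tv)=E[\widetilde h(o,\mathbf X)\widetilde h(tv,\mathbf X)]$ and $J(t)=\int_{\mathbb S^{d-1}}\widetilde F(o,tv)\,\mathrm dv$. A single realization of $\mathbf X$ is observed in $W_n$, where $(W_n)_{n\ge1}$ is a sequence of cubes growing up to $\mathbb R^d$. $W_{n\ominus 2R}=\{u\in W_n:B(u,2R)\subset W_n\}$ denotes the $2R$-interior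 of $W_n$, with $|W_{n\ominus 2R}|>0$. The sign $\sum^{\neq}$ means summation over distinct pairs (ordered pairs $(u,v)$ with $u\ne v$). Condition $K(1,\alpha)$: the bandwidths $b_n>0$ satisfy $\lim_n b_n=0$ and $\lim_n b_n|W_{n\ominus 2R}|=\infty$; the kernel $K_1:\mathbb R\to\mathbb R$ is non-negative, bounded, with bounded support, $\int_{\mathbb R}K_1(u)\,\mathrm du=1$, and $\int_{\mathbb R}u^jK_1(u)\,\mathrm du=0$ for $j=1,\dots,\alpha-1$ (no moment condition when $\alpha=1$). The estimator is $$\widehat R_n(r)=\frac{1}{b_n|W_{n\ominus 2R}|\sigma_d}\sum_{u,v\in\mathbf X,\ \|v-u\|\le R}^{\neq}\frac{\mathbf 1_{W_{n\ominus 2R}}(u)}{\|v-u\|^{d-1}}\,\widetilde h(u,\mathbf X\setminus\{u,v\})\,\widetilde h(v,\mathbf X\setminus\{u,v\})\,K_1\Big(\frac{\|v-u\|-r}{b_n}\Big).$$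
   Formalization: In (i), continuity of γ at r is added, which excludes r=R (γ jumps there). Without it (i) fails: for γ constant on [0,R], K_1 uniform on [-1,1] and r=R, the limit is half the stated value; changing γ at a single point also breaks it. *)

theory Defs
  imports "HOL-Probability.Probability" "HOL-Library.Landau_Symbols"
begin

text \<open>Configurations are sets of points, so point processes are simple.\<close>

definition locally_finite :: "(real ^ 'n) set \<Rightarrow> bool" where
  "locally_finite x \<longleftrightarrow> (\<forall>B. bounded B \<longrightarrow> finite (x \<inter> B))"

definition Nlf :: "(real ^ 'n) set measure" where
  "Nlf = sigma {x. locally_finite x}
     {{x. locally_finite x \<and> card (x \<inter> B) = k} | B k. bounded B \<and> B \<in> sets borel}"

definition point_process :: "'w measure \<Rightarrow> ('w \<Rightarrow> (real ^ 'n) set) \<Rightarrow> bool" where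
  "point_process M X \<longleftrightarrow> prob_space M \<and> X \<in> measurable M Nlf"

definition stationary :: "'w measure \<Rightarrow> ('w \<Rightarrow> (real ^ 'n) set) \<Rightarrow> bool" where
  "stationary M X \<longleftrightarrow> (\<forall>a. distr M Nlf (\<lambda>\<omega>. (\<lambda>u. a + u) ` X \<omega>) = distr M Nlf X)"

definition isotropic :: "'w measure \<Rightarrow> ('w \<Rightarrow> (real ^ 'n) set) \<Rightarrow> bool" where
  "isotropic M X \<longleftrightarrow>
     (\<forall>Q. rotation_matrix Q \<longrightarrow> distr M Nlf (\<lambda>\<omega>. (\<lambda>u. Q *v u) ` X \<omega>) = distr M Nlf X)"

text \<open>The sum over the points of the configuration is the integral with respect to the
  counting measure on it.\<close>

definition papangelou_intensity ::
    "'w measure \<Rightarrow> ('w \<Rightarrow> (real ^ 'n) set) \<Rightarrow> (real ^ 'n \<Rightarrow> (real ^ 'n) set \<Rightarrow> real) \<Rightarrow> bool" where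
  "papangelou_intensity M X ci \<longleftrightarrow>
     (\<lambda>(u, x). ci u x) \<in> borel_measurable (borel \<Otimes>\<^sub>M Nlf) \<and>
     (\<forall>u. \<forall>x. locally_finite x \<longrightarrow> 0 \<le> ci u x) \<and>
     (\<forall>h :: real ^ 'n \<Rightarrow> (real ^ 'n) set \<Rightarrow> ennreal.
        (\<lambda>(u, x). h u x) \<in> borel_measurable (borel \<Otimes>\<^sub>M Nlf) \<longrightarrow>
        (\<integral>\<^sup>+\<omega>. (\<integral>\<^sup>+u. h u (X \<omega> - {u}) \<partial>count_space (X \<omega>)) \<partial>M)
          = (\<integral>\<^sup>+u. (\<integral>\<^sup>+\<omega>. h u (X \<omega>) * ennreal (ci u (X \<omega>)) \<partial>M) \<partial>lborel))"

text \<open>A sum over a possibly infinite configuration is an unordered sum \<open>infsum\<close>, since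
  \<open>sum\<close> is 0 on infinite index sets. When \<open>\<gamma>\<close> vanishes beyond \<open>R\<close> and \<open>x\<close> is locally
  finite, only finitely many terms are non-zero.\<close>

definition pairwise_intensity ::
    "real \<Rightarrow> (real \<Rightarrow> real) \<Rightarrow> real ^ 'n \<Rightarrow> (real ^ 'n) set \<Rightarrow> real" where
  "pairwise_intensity \<beta> \<gamma> u x = \<beta> * exp (- (\<Sum>\<^sub>\<infinity>v\<in>x - {u}. \<gamma> (norm (v - u))))"

text \<open>The distance is extended real so that the distance to the empty configuration is
  \<open>\<infinity>\<close> (the library's \<open>infdist\<close> gives 0 there).\<close>

definition dist_conf :: "real ^ 'n \<Rightarrow> (real ^ 'n) set \<Rightarrow> ereal" where
  "dist_conf u x = (INF v\<in>x. ereal (norm (v - u)))"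

definition h_tilde :: "real \<Rightarrow> real ^ 'n \<Rightarrow> (real ^ 'n) set \<Rightarrow> real" where
  "h_tilde R u x = of_bool (dist_conf u x > ereal R)"

definition F_tilde ::
    "'w measure \<Rightarrow> ('w \<Rightarrow> (real ^ 'n) set) \<Rightarrow> real \<Rightarrow> real ^ 'n \<Rightarrow> real ^ 'n \<Rightarrow> real" where
  "F_tilde M X R u v = (\<integral>\<omega>. h_tilde R u (X \<omega>) * h_tilde R v (X \<omega>) \<partial>M)"

text \<open>The uniform distribution on the unit sphere is the law of the direction \<open>z / norm z\<close>
  of a point \<open>z\<close> that is uniformly distributed in the unit ball.\<close>

definition sphere_unif :: "(real ^ 'n) measure" where
  "sphere_unif = distr (uniform_measure lborel (ball 0 1)) borel sgn"

definition J_fun :: "'w measure \<Rightarrow> ('w \<Rightarrow> (real ^ 'n) set) \<Rightarrow> real \<Rightarrow> real \<Rightarrow> real" where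
  "J_fun M X R t = (\<integral>v. F_tilde M X R 0 (t *\<^sub>R v) \<partial>sphere_unif)"

definition sphere_surface :: "nat \<Rightarrow> real" where
  "sphere_surface d = 2 * pi powr (real d / 2) / Gamma (real d / 2)"

definition is_cube :: "(real ^ 'n) set \<Rightarrow> bool" where
  "is_cube W \<longleftrightarrow> (\<exists>a s. 0 < s \<and> W = cbox a (\<chi> i. a $ i + s))"

definition erosion :: "(real ^ 'n) set \<Rightarrow> real \<Rightarrow> (real ^ 'n) set" where
  "erosion W \<rho> = {u \<in> W. cball u \<rho> \<subseteq> W}"

text \<open>The sequence \<open>w\<close> stands for the volumes of the eroded observation windows.\<close>

definition condition_K :: "nat \<Rightarrow> (real \<Rightarrow> real) \<Rightarrow> (nat \<Rightarrow> real) \<Rightarrow> (nat \<Rightarrow> real) \<Rightarrow> bool" where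
  "condition_K \<alpha> K b w \<longleftrightarrow>
     (\<forall>n. 0 < b n) \<and> b \<longlonglongrightarrow> 0 \<and> filterlim (\<lambda>n. b n * w n) at_top sequentially \<and>
     K \<in> borel_measurable borel \<and> (\<forall>u. 0 \<le> K u) \<and> bounded (range K) \<and>
     bounded {u. K u \<noteq> 0} \<and> (\<integral>u. K u \<partial>lborel) = 1 \<and>
     (\<forall>j\<in>{1..<\<alpha>}. (\<integral>u. u ^ j * K u \<partial>lborel) = 0)"

definition R_hat ::
    "(real \<Rightarrow> real) \<Rightarrow> real \<Rightarrow> real \<Rightarrow> (real ^ 'n) set \<Rightarrow> real \<Rightarrow> (real ^ 'n) set \<Rightarrow> real" where
  "R_hat K R b W r x =
     1 / (b * measure lborel (erosion W (2 * R)) * sphere_surface CARD('n)) *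
     (\<Sum>\<^sub>\<infinity>(u, v)\<in>{(u, v). u \<in> x \<and> v \<in> x \<and> u \<noteq> v \<and> norm (v - u) \<le> R}.
        indicator (erosion W (2 * R)) u / norm (v - u) ^ (CARD('n) - 1) *
        h_tilde R u (x - {u, v}) * h_tilde R v (x - {u, v}) * K ((norm (v - u) - r) / b))"

definition bounded_continuous_deriv :: "nat \<Rightarrow> (real \<Rightarrow> real) \<Rightarrow> real set \<Rightarrow> bool" where
  "bounded_continuous_deriv k f I \<longleftrightarrow>
     (\<forall>j<k. \<forall>t\<in>I. (deriv ^^ j) f differentiable (at t)) \<and>
     continuous_on I ((deriv ^^ k) f) \<and> bounded ((deriv ^^ k) f ` I)"

end

theory Submission
  imports Defs
begin

text \<open>
  Applying the Papangelou (Georgii--Nguyen--Zessin) identity twice turns the expected sum over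
  pairs into an integral of \<open>\<lambda>(u, X \<union> {v}) \<lambda>(v, X)\<close>. On the event that \<open>X\<close> has no point within
  distance \<open>R\<close> of \<open>u\<close> or \<open>v\<close> this product is \<open>\<beta>\<^sup>2 exp (- \<gamma> (norm (v - u)))\<close>. By stationarity and
  polar coordinates the expectation of the estimator is therefore \<open>\<beta>\<^sup>2\<close> times the smoothing with
  \<open>K\<close> at bandwidth \<open>b\<close> of \<open>f t = exp (- \<gamma> t) * J t\<close> restricted to \<open>(0, R]\<close>. Part (i) follows from
  continuity of \<open>J\<close>, which holds because almost surely no point of \<open>X\<close> lies on a given sphere;
  part (ii) follows from Taylor's formula. A non-negative kernel has a positive second moment,
  so only \<open>\<alpha> \<le> 2\<close> can occur in (ii).
\<close>

section \<open>Measurability on the space of configurations\<close>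

text \<open>Finiteness of the moments involved is not known beforehand, so the expectation is
  computed in \<open>ennreal\<close>; the return to real integrals goes through
  \<open>enn2real\<close>, whose value 0 at infinity agrees with the default of the Bochner
  integral. The price is joint measurability of everything inserted into the Papangelou identity:
  the inner sum over points, and configurations with a point added or removed. The measurability of
  \<gamma> on the positive half-line is extracted from the conditional intensity itself. The volume
  of the eroded window cancels exactly, so the expectation depends on n only through the bandwidth,
  and the asymptotics concern a single function on the line. The delicate point is r = R, where
  \<gamma> jumps from a positive value to 0. In part (i), continuity of \<gamma> at r already places
  r below R. In part (ii), the Taylor polynomial at R has to vanish; a minimum at R controls only
  the value and the first derivative, and this is enough because the moment conditions exclude
  orders above 2.\<close>

lemma space_Nlf [simp]: "space Nlf = {x. locally_finite x}"
  by (simp add: Nlf_def space_measure_of_conv)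

lemma sets_Nlf:
  "sets (Nlf :: (real ^ 'n) set measure) = sigma_sets {x. locally_finite x}
     {{x. locally_finite x \<and> card (x \<inter> B) = k} | B k. bounded B \<and> B \<in> sets borel}"
  unfolding Nlf_def by (rule sets_measure_of) auto

lemma locally_finiteD: "locally_finite x \<Longrightarrow> bounded B \<Longrightarrow> finite (x \<inter> B)"
  by (simp add: locally_finite_def)

lemma locally_finite_subset: "locally_finite x \<Longrightarrow> y \<subseteq> x \<Longrightarrow> locally_finite y"
  unfolding locally_finite_def by (meson Int_mono finite_subset order_refl)

lemma locally_finite_insert: "locally_finite x \<Longrightarrow> locally_finite (insert v x)"
  unfolding locally_finite_def by (simp add: Int_insert_left)

lemma locally_finite_translation:
  fixes x :: "(real ^ 'n) set"
  assumes "locally_finite x"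
  shows "locally_finite ((\<lambda>u. a + u) ` x)"
  unfolding locally_finite_def
proof safe
  fix B :: "(real ^ 'n) set" assume "bounded B"
  then have "bounded ((\<lambda>u. - a + u) ` B)" by (rule bounded_translation)
  then have "finite ((\<lambda>u. a + u) ` (x \<inter> (\<lambda>u. - a + u) ` B))"
    using assms locally_finiteD by blast
  moreover have "(\<lambda>u. a + u) ` x \<inter> B \<subseteq> (\<lambda>u. a + u) ` (x \<inter> (\<lambda>u. - a + u) ` B)"
    by (auto simp: image_iff algebra_simps)
  ultimately show "finite ((\<lambda>u. a + u) ` x \<inter> B)" by (rule finite_subset[rotated])
qed

lemma measurable_card_Nlf:
  assumes "bounded B" "B \<in> sets borel"
  shows "(\<lambda>x. card (x \<inter> B)) \<in> measurable Nlf (count_space UNIV)"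
proof (subst measurable_count_space_eq_countable, safe)
  fix k :: nat
  have "(\<lambda>x. card (x \<inter> B)) -` {k} \<inter> space Nlf = {x. locally_finite x \<and> card (x \<inter> B) = k}"
    by auto
  then show "(\<lambda>x. card (x \<inter> B)) -` {k} \<inter> space Nlf \<in> sets Nlf"
    unfolding sets_Nlf using assms by (auto intro!: sigma_sets.Basic)
qed auto

lemma measurable_NlfI:
  fixes f :: "'a \<Rightarrow> (real ^ 'n) set"
  assumes lf: "\<And>\<omega>. \<omega> \<in> space N \<Longrightarrow> locally_finite (f \<omega>)"
    and card: "\<And>B. bounded B \<Longrightarrow> B \<in> sets borel \<Longrightarrow>
      (\<lambda>\<omega>. card (f \<omega> \<inter> B)) \<in> measurable N (count_space UNIV)"
  shows "f \<in> measurable N Nlf"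
  unfolding Nlf_def
proof (rule measurable_measure_of)
  show "f \<in> space N \<rightarrow> {x. locally_finite x}" using lf by auto
  fix Y assume "Y \<in> {{x :: (real ^ 'n) set. locally_finite x \<and> card (x \<inter> B) = k} | B k. bounded B \<and> B \<in> sets borel}"
  then obtain B k where B: "bounded B" "B \<in> sets borel"
    and Y: "Y = {x. locally_finite x \<and> card (x \<inter> B) = k}" by auto
  have "f -` Y \<inter> space N = (\<lambda>\<omega>. card (f \<omega> \<inter> B)) -` {k} \<inter> space N"
    using lf by (auto simp: Y)
  also have "\<dots> \<in> sets N" by (rule measurable_sets[OF card[OF B]]) auto
  finally show "f -` Y \<inter> space N \<in> sets N" .
qed auto

text \<open>Only finitely many points lie in the ball of radius \<open>\<rho> + 1\<close>, so the
  smallest of their distances exceeds \<open>\<rho>\<close> strictly. The gap yields a strict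
  inequality for the distance to the configuration and makes emptiness of a ball stable under small
  moves of its centre.\<close>

lemma locally_finite_cball_gap:
  fixes u :: "real ^ 'n"
  assumes lf: "locally_finite x" and empty: "x \<inter> cball u \<rho> = {}"
  obtains m where "\<rho> < m" "\<And>p. p \<in> x \<Longrightarrow> m \<le> dist u p"
proof
  \<comment> \<open>The extra entry \<open>\<rho> + 1\<close> keeps the set non-empty and is a lower
    bound for the distance of all points outside the larger ball.\<close>
  define D where "D = insert (\<rho> + 1) (dist u ` (x \<inter> cball u (\<rho> + 1)))"
  have fin: "finite D" "D \<noteq> {}"
    unfolding D_def using locally_finiteD[OF lf bounded_cball] by auto
  show "\<rho> < Min D" using fin empty by (auto simp: D_def)
  fix p assume "p \<in> x"
  show "Min D \<le> dist u p"
  proof (cases "dist u p \<le> \<rho> + 1")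
    case True
    with \<open>p \<in> x\<close> fin show ?thesis by (intro Min_le) (auto simp: D_def)
  next
    case False
    moreover have "Min D \<le> \<rho> + 1" using fin by (intro Min_le) (auto simp: D_def)
    ultimately show ?thesis by simp
  qed
qed

text \<open>Testing only centres in a countable dense set reduces joint measurability of the hitting
  event in the ball's centre and the configuration to the counting maps generating \<open>Nlf\<close>;
  the case \<open>\<rho> = 0\<close> is membership.\<close>

lemma meets_cball_iff:
  fixes u :: "real ^ 'n"
  assumes lf: "locally_finite x" and D: "\<And>S :: (real ^ 'n) set. open S \<Longrightarrow> S \<noteq> {} \<Longrightarrow> \<exists>d\<in>D. d \<in> S"
    and "0 \<le> \<rho>"
  shows "x \<inter> cball u \<rho> \<noteq> {} \<longleftrightarrow>
    (\<forall>k. \<exists>q\<in>D. dist u q < 1 / real (Suc k) \<and> card (x \<inter> cball q (\<rho> + 1 / real (Suc k))) \<noteq> 0)"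
proof (intro iffI allI)
  fix k
  assume "x \<inter> cball u \<rho> \<noteq> {}"
  then obtain p where p: "p \<in> x" "dist u p \<le> \<rho>" by auto
  obtain q where q: "q \<in> D" "q \<in> ball u (1 / real (Suc k))"
    using D[of "ball u (1 / real (Suc k))"] by auto
  have "dist q p \<le> dist u q + dist u p" by (metis dist_commute dist_triangle)
  with p q have "p \<in> x \<inter> cball q (\<rho> + 1 / real (Suc k))" by auto
  then show "\<exists>q\<in>D. dist u q < 1 / real (Suc k) \<and> card (x \<inter> cball q (\<rho> + 1 / real (Suc k))) \<noteq> 0"
    using q locally_finiteD[OF lf bounded_cball, of q "\<rho> + 1 / real (Suc k)"]
    by (intro bexI[of _ q]) (auto simp: card_eq_0_iff)
next
  assume hits: "\<forall>k. \<exists>q\<in>D. dist u q < 1 / real (Suc k) \<and> card (x \<inter> cball q (\<rho> + 1 / real (Suc k))) \<noteq> 0"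
  have near: "\<exists>p\<in>x. dist u p \<le> \<rho> + 2 / real (Suc k)" for k
  proof -
    obtain q where q: "dist u q < 1 / real (Suc k)" "x \<inter> cball q (\<rho> + 1 / real (Suc k)) \<noteq> {}"
      using hits by (metis card.empty)
    then obtain p where "p \<in> x" "dist q p \<le> \<rho> + 1 / real (Suc k)" by auto
    moreover have "dist u p \<le> dist u q + dist q p" by (rule dist_triangle)
    ultimately show ?thesis using q(1) by (intro bexI[of _ p]) auto
  qed
  show "x \<inter> cball u \<rho> \<noteq> {}"
  proof
    assume empty: "x \<inter> cball u \<rho> = {}"
    then obtain m where m: "\<rho> < m" "\<And>p. p \<in> x \<Longrightarrow> m \<le> dist u p"
      using locally_finite_cball_gap[OF lf] by metis
    then obtain k where k: "2 / real (Suc k) < m - \<rho>"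
      using reals_Archimedean[of "(m - \<rho>) / 2"] by (auto simp: field_simps)
    obtain p where p: "p \<in> x" "dist u p \<le> \<rho> + 2 / real (Suc k)" using near[of k] by auto
    with m p k show False by force
  qed
qed

lemma pred_meets_cball:
  assumes "0 \<le> \<rho>"
  shows "Measurable.pred (borel \<Otimes>\<^sub>M Nlf) (\<lambda>(u :: real ^ 'n, x). x \<inter> cball u \<rho> \<noteq> {})"
proof -
  obtain D :: "(real ^ 'n) set" where D: "countable D" "\<And>S. open S \<Longrightarrow> S \<noteq> {} \<Longrightarrow> \<exists>d\<in>D. d \<in> S"
    using countable_dense_exists by blast
  have [measurable]: "(\<lambda>z. card (snd z \<inter> cball q \<epsilon>)) \<in> measurable (borel \<Otimes>\<^sub>M Nlf) (count_space UNIV)"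
    for q :: "real ^ 'n" and \<epsilon> :: real
    by (rule measurable_compose[OF measurable_snd measurable_card_Nlf]) auto
  have [measurable]: "countable D" by fact
  have "Measurable.pred (borel \<Otimes>\<^sub>M Nlf) (\<lambda>z :: (real ^ 'n) \<times> _. \<forall>k. \<exists>q\<in>D. dist (fst z) q < 1 / real (Suc k) \<and>
      card (snd z \<inter> cball q (\<rho> + 1 / real (Suc k))) \<noteq> 0)"
    by (intro pred_intros_countable pred_intros_countable_bounded D) measurable
  also have "?this \<longleftrightarrow> ?thesis"
    by (intro measurable_cong) (simp add: split_beta space_pair_measure mem_Times_iff meets_cball_iff[OF _ D(2) assms] del: of_nat_Suc)
  finally show ?thesis .
qed

lemma pred_member_Nlf:
  "Measurable.pred (borel \<Otimes>\<^sub>M Nlf) (\<lambda>(v :: real ^ 'n, x). v \<in> x)"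
proof -
  have "(\<lambda>(v :: real ^ 'n, x). v \<in> x) = (\<lambda>(v, x). x \<inter> cball v 0 \<noteq> {})" by auto
  then show ?thesis using pred_meets_cball[of 0] by simp
qed

text \<open>A count drops by one exactly when the deleted point lies both in the configuration and
  in \<open>B\<close>, so joint measurability reduces to that of membership. Insertion is treated in
  the same way with the sign reversed.\<close>

lemma measurable_delete_point:
  "(\<lambda>(v, x). x - {v}) \<in> measurable (borel \<Otimes>\<^sub>M Nlf) (Nlf :: (real ^ 'n) set measure)"
proof (rule measurable_NlfI)
  fix z :: "(real ^ 'n) \<times> (real ^ 'n) set" assume "z \<in> space (borel \<Otimes>\<^sub>M Nlf)"
  then show "locally_finite (case z of (v, x) \<Rightarrow> x - {v})"
    by (auto simp: space_pair_measure intro: locally_finite_subset)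
next
  fix B :: "(real ^ 'n) set" assume B: "bounded B" "B \<in> sets borel"
  note [measurable] = pred_member_Nlf B(2)
  have [measurable]: "(\<lambda>z. card (snd z \<inter> B)) \<in> measurable (borel \<Otimes>\<^sub>M Nlf) (count_space UNIV)"
    by (rule measurable_compose[OF measurable_snd measurable_card_Nlf[OF B]])
  have "(\<lambda>(v, x). if v \<in> x \<and> v \<in> B then card (x \<inter> B) - 1 else card (x \<inter> B))
      \<in> measurable (borel \<Otimes>\<^sub>M Nlf) (count_space UNIV)"
    unfolding split_beta by measurable
  also have "?this \<longleftrightarrow> (\<lambda>z. card ((case z of (v, x) \<Rightarrow> x - {v}) \<inter> B))
      \<in> measurable (borel \<Otimes>\<^sub>M Nlf) (count_space UNIV)"
  proof (intro measurable_cong)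
    fix z :: "(real ^ 'n) \<times> (real ^ 'n) set" assume "z \<in> space (borel \<Otimes>\<^sub>M Nlf)"
    then have "finite (snd z \<inter> B)" using B by (auto simp: space_pair_measure locally_finiteD)
    moreover have "(snd z - {fst z}) \<inter> B = snd z \<inter> B - {fst z}" by auto
    ultimately show "(case z of (v, x) \<Rightarrow> if v \<in> x \<and> v \<in> B then card (x \<inter> B) - 1 else card (x \<inter> B))
        = card ((case z of (v, x) \<Rightarrow> x - {v}) \<inter> B)"
      by (auto simp: split_beta card_Diff_singleton)
  qed
  finally show "(\<lambda>z. card ((case z of (v, x) \<Rightarrow> x - {v}) \<inter> B))
      \<in> measurable (borel \<Otimes>\<^sub>M Nlf) (count_space UNIV)" .
qed

lemma measurable_insert_point:
  "(\<lambda>(v, x). insert v x) \<in> measurable (borel \<Otimes>\<^sub>M Nlf) (Nlf :: (real ^ 'n) set measure)"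
proof (rule measurable_NlfI)
  fix z :: "(real ^ 'n) \<times> (real ^ 'n) set" assume "z \<in> space (borel \<Otimes>\<^sub>M Nlf)"
  then show "locally_finite (case z of (v, x) \<Rightarrow> insert v x)"
    by (auto simp: space_pair_measure intro: locally_finite_insert)
next
  fix B :: "(real ^ 'n) set" assume B: "bounded B" "B \<in> sets borel"
  note [measurable] = pred_member_Nlf B(2)
  have [measurable]: "(\<lambda>z. card (snd z \<inter> B)) \<in> measurable (borel \<Otimes>\<^sub>M Nlf) (count_space UNIV)"
    by (rule measurable_compose[OF measurable_snd measurable_card_Nlf[OF B]])
  have "(\<lambda>(v, x). if v \<notin> x \<and> v \<in> B then Suc (card (x \<inter> B)) else card (x \<inter> B))
      \<in> measurable (borel \<Otimes>\<^sub>M Nlf) (count_space UNIV)"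
    unfolding split_beta by measurable
  also have "?this \<longleftrightarrow> (\<lambda>z. card ((case z of (v, x) \<Rightarrow> insert v x) \<inter> B))
      \<in> measurable (borel \<Otimes>\<^sub>M Nlf) (count_space UNIV)"
  proof (intro measurable_cong)
    fix z :: "(real ^ 'n) \<times> (real ^ 'n) set" assume "z \<in> space (borel \<Otimes>\<^sub>M Nlf)"
    then have "finite (snd z \<inter> B)" using B by (auto simp: space_pair_measure locally_finiteD)
    then show "(case z of (v, x) \<Rightarrow> if v \<notin> x \<and> v \<in> B then Suc (card (x \<inter> B)) else card (x \<inter> B))
        = card ((case z of (v, x) \<Rightarrow> insert v x) \<inter> B)"
      by (auto simp: split_beta Int_insert_left insert_absorb)
  qed
  finally show "(\<lambda>z. card ((case z of (v, x) \<Rightarrow> insert v x) \<inter> B))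
      \<in> measurable (borel \<Otimes>\<^sub>M Nlf) (count_space UNIV)" .
qed

lemma measurable_translation_Nlf:
  "(\<lambda>x. (\<lambda>u. a + u) ` x) \<in> measurable Nlf (Nlf :: (real ^ 'n) set measure)"
proof (rule measurable_NlfI)
  fix x :: "(real ^ 'n) set" assume "x \<in> space Nlf"
  then show "locally_finite ((\<lambda>u. a + u) ` x)" by (auto intro: locally_finite_translation)
next
  fix B :: "(real ^ 'n) set" assume B: "bounded B" "B \<in> sets borel"
  define C where "C = (\<lambda>u. - a + u) ` B"
  have "C = (\<lambda>u. a + u) -` B \<inter> space borel"
    by (auto simp: C_def image_iff) (metis add.commute add_diff_cancel diff_conv_add_uminus)
  also have "\<dots> \<in> sets borel" using B(2) by (intro measurable_sets[where A = borel]) auto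
  finally have "C \<in> sets borel" .
  moreover have "bounded C" unfolding C_def by (rule bounded_translation[OF B(1)])
  ultimately have "(\<lambda>x. card (x \<inter> C)) \<in> measurable Nlf (count_space UNIV)"
    by (intro measurable_card_Nlf)
  also have "(\<lambda>x. card (x \<inter> C)) = (\<lambda>x. card ((\<lambda>u. a + u) ` x \<inter> B))"
  proof
    fix x
    have "(\<lambda>u. a + u) ` x \<inter> B = (\<lambda>u. a + u) ` (x \<inter> C)"
      by (auto simp: C_def image_iff algebra_simps)
    then show "card (x \<inter> C) = card ((\<lambda>u. a + u) ` x \<inter> B)" by (simp add: card_image)
  qed
  finally show "(\<lambda>x. card ((\<lambda>u. a + u) ` x \<inter> B)) \<in> measurable Nlf (count_space UNIV)" .
qed

text \<open>On a rectangle the sum is a count times an indicator; a Dynkin-system argument extends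
  this to all measurable sets. Complements are handled by subtraction, which in
  \<open>ennreal\<close> needs finite values. This is why the sum is cut down to a ball, where local
  finiteness applies.\<close>

lemma measurable_sum_indicator_cball:
  fixes Y :: "'a \<Rightarrow> (real ^ 'n) set"
  assumes Y: "Y \<in> measurable N Nlf" and S: "S \<in> sets (borel \<Otimes>\<^sub>M N)"
  shows "(\<lambda>z. \<integral>\<^sup>+v. indicator S (v, z) * indicator (cball 0 \<rho>) v \<partial>count_space (Y z)) \<in> borel_measurable N"
    (is "?c S \<in> _")
proof -
  have lf: "locally_finite (Y z)" if "z \<in> space N" for z
    using measurable_space[OF Y that] by simp
  have sum_eq: "?c (A \<times> B) z = of_nat (card (Y z \<inter> (A \<inter> cball 0 \<rho>))) * indicator B z"
    if "z \<in> space N" for A B z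
  proof -
    have "finite (Y z \<inter> (A \<inter> cball 0 \<rho>))"
      by (rule locally_finiteD[OF lf[OF that]]) (auto intro: bounded_subset)
    then have "?c (A \<times> B) z = (\<Sum>v\<in>Y z \<inter> (A \<inter> cball 0 \<rho>). indicator (A \<times> B) (v, z) * indicator (cball 0 \<rho>) v)"
      by (intro nn_integral_count_space') (auto simp: indicator_def)
    also have "\<dots> = (\<Sum>v\<in>Y z \<inter> (A \<inter> cball 0 \<rho>). indicator B z)"
      by (intro sum.cong) (auto simp: indicator_def)
    finally show ?thesis by simp
  qed
  have rect: "?c (A \<times> B) \<in> borel_measurable N" if "A \<in> sets borel" "B \<in> sets N" for A B
  proof -
    have "(\<lambda>x. card (x \<inter> (A \<inter> cball 0 \<rho>))) \<in> measurable Nlf (count_space UNIV)"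
      using that by (intro measurable_card_Nlf) (auto intro: bounded_subset)
    note [measurable] = measurable_compose[OF Y this] that(2)
    have "(\<lambda>z. of_nat (card (Y z \<inter> (A \<inter> cball 0 \<rho>))) * indicator B z :: ennreal) \<in> borel_measurable N"
      by measurable
    also have "?this \<longleftrightarrow> ?thesis" by (intro measurable_cong) (simp only: sum_eq)
    finally show ?thesis .
  qed
  have fin: "?c S z \<noteq> \<infinity>" if "z \<in> space N" for z S
  proof -
    have "?c S z \<le> ?c (UNIV \<times> UNIV) z"
      by (intro nn_integral_mono) (auto simp: indicator_def)
    also have "\<dots> < \<infinity>" by (simp only: sum_eq[OF that]) (simp add: ennreal_mult_less_top of_nat_less_top)
    finally show ?thesis by simp
  qed
  show ?thesis
    using Int_stable_pair_measure_generator pair_measure_closed S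
    unfolding sets_pair_measure
  proof (induct rule: sigma_sets_induct_disjoint)
    case (basic A)
    then show ?case using rect by auto
  next
    case empty
    show ?case by simp
  next
    case (compl A)
    have "?c (space borel \<times> space N - A) z = ?c (space borel \<times> space N) z - ?c A z" if "z \<in> space N" for z
    proof -
      have "A \<subseteq> space borel \<times> space N"
        using compl(1) sets.sets_into_space[of A "borel \<Otimes>\<^sub>M N"]
        by (simp add: space_pair_measure sets_pair_measure)
      then have "?c (space borel \<times> space N) z
          = (\<integral>\<^sup>+v. indicator (space borel \<times> space N - A) (v, z) * indicator (cball 0 \<rho>) v +
               indicator A (v, z) * indicator (cball 0 \<rho>) v \<partial>count_space (Y z))"
        by (intro nn_integral_cong) (auto simp: indicator_def)
      also have "\<dots> = ?c (space borel \<times> space N - A) z + ?c A z"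
        by (rule nn_integral_add) auto
      finally show ?thesis
        using fin[OF that, of A] by (simp add: ennreal_add_diff_cancel_right)
    qed
    moreover have "(\<lambda>z. ?c (space borel \<times> space N) z - ?c A z) \<in> borel_measurable N"
      using compl(2) rect[of "space borel" "space N"] by measurable
    ultimately show ?case by (subst measurable_cong) auto
  next
    case (union F)
    have "?c (\<Union>i. F i) z = (\<Sum>i. ?c (F i) z)" for z
    proof -
      have "indicator (\<Union>i. F i) (v, z) = (\<Sum>i. indicator (F i) (v, z) :: ennreal)" for v
        by (rule suminf_indicator[OF union(1), symmetric])
      then have "?c (\<Union>i. F i) z = (\<integral>\<^sup>+v. (\<Sum>i. indicator (F i) (v, z) * indicator (cball 0 \<rho>) v) \<partial>count_space (Y z))"
        by simp
      also have "\<dots> = (\<Sum>i. ?c (F i) z)" by (rule nn_integral_suminf) simp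
      finally show ?thesis .
    qed
    then show ?case using union(3) by simp
  qed
qed

text \<open>The measure \<open>count_space (Y z)\<close> varies with the parameter, so measurability
  of integrals against a fixed measure does not apply. In the indicator case of the induction the
  cut-off disappears by monotone convergence along balls of radius \<open>k\<close>.\<close>

lemma measurable_sum_Nlf:
  fixes Y :: "'a \<Rightarrow> (real ^ 'n) set" and f :: "(real ^ 'n) \<times> 'a \<Rightarrow> ennreal"
  assumes Y: "Y \<in> measurable N Nlf" and f: "f \<in> borel_measurable (borel \<Otimes>\<^sub>M N)"
  shows "(\<lambda>z. \<integral>\<^sup>+v. f (v, z) \<partial>count_space (Y z)) \<in> borel_measurable N"
  using f
proof induct
  case (cong f g)
  have "(\<lambda>z. \<integral>\<^sup>+v. f (v, z) \<partial>count_space (Y z)) \<in> borel_measurable N \<longleftrightarrow>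
        (\<lambda>z. \<integral>\<^sup>+v. g (v, z) \<partial>count_space (Y z)) \<in> borel_measurable N"
    by (intro measurable_cong nn_integral_cong cong(3)) (auto simp: space_pair_measure)
  with cong show ?case by simp
next
  case (set S)
  have "(\<integral>\<^sup>+v. indicator S (v, z) \<partial>count_space (Y z))
      = (SUP k. \<integral>\<^sup>+v. indicator S (v, z) * indicator (cball 0 (real k)) v \<partial>count_space (Y z))" for z
  proof -
    have "(SUP k. indicator (cball 0 (real k)) v :: ennreal) = 1" for v :: "real ^ 'n"
    proof (rule antisym)
      show "(SUP k. indicator (cball 0 (real k)) v :: ennreal) \<le> 1"
        by (rule SUP_least) (auto simp: indicator_def)
      obtain k where "norm v \<le> real k" using real_arch_simple by blast
      then show "1 \<le> (SUP k. indicator (cball 0 (real k)) v :: ennreal)"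
        by (intro SUP_upper2[of k]) (auto simp: indicator_def)
    qed
    then have "(\<integral>\<^sup>+v. indicator S (v, z) \<partial>count_space (Y z))
      = (\<integral>\<^sup>+v. (SUP k. indicator S (v, z) * indicator (cball 0 (real k)) v) \<partial>count_space (Y z))"
      by (simp add: SUP_mult_left_ennreal[symmetric])
    also have "\<dots> = (SUP k. \<integral>\<^sup>+v. indicator S (v, z) * indicator (cball 0 (real k)) v \<partial>count_space (Y z))"
      by (intro nn_integral_monotone_convergence_SUP) (auto simp: incseq_def le_fun_def indicator_def)
    finally show ?thesis .
  qed
  then show ?case
    using measurable_sum_indicator_cball[OF Y set] by simp
next
  case (mult u c)
  then show ?case by (simp add: nn_integral_cmult)
next
  case (add u v)
  then show ?case by (simp add: nn_integral_add)
next
  case (seq U)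
  have "(\<integral>\<^sup>+v. (SUP i. U i) (v, z) \<partial>count_space (Y z)) = (SUP i. \<integral>\<^sup>+v. U i (v, z) \<partial>count_space (Y z))" for z
    using seq(4) unfolding SUP_apply
    by (intro nn_integral_monotone_convergence_SUP) (auto simp: incseq_def le_fun_def)
  with seq(3) show ?case by simp
qed

text \<open>This makes the inner sum over second points an admissible test function for the first
  application of the Papangelou identity.\<close>

lemma measurable_sum_delete_point:
  fixes f :: "(real ^ 'n) \<times> (real ^ 'n) \<times> (real ^ 'n) set \<Rightarrow> ennreal"
  assumes f [measurable]: "f \<in> borel_measurable (borel \<Otimes>\<^sub>M borel \<Otimes>\<^sub>M Nlf)"
  shows "(\<lambda>(u, x). \<integral>\<^sup>+v. f (u, v, x - {v}) \<partial>count_space x) \<in> borel_measurable (borel \<Otimes>\<^sub>M Nlf)"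
proof -
  let ?N = "(borel :: (real ^ 'n) measure) \<Otimes>\<^sub>M (borel :: (real ^ 'n) measure) \<Otimes>\<^sub>M (Nlf :: (real ^ 'n) set measure)"
  have "(\<lambda>z. (fst z, snd (snd z))) \<in> measurable ?N (borel \<Otimes>\<^sub>M Nlf)"
    by measurable
  from measurable_compose[OF this measurable_delete_point]
  have [measurable]: "(\<lambda>z. snd (snd z) - {fst z}) \<in> measurable ?N Nlf"
    by (simp add: split_beta)
  have "(\<lambda>z. f (fst (snd z), fst z, snd (snd z) - {fst z})) \<in> borel_measurable (borel \<Otimes>\<^sub>M borel \<Otimes>\<^sub>M Nlf)"
    by measurable
  from measurable_sum_Nlf[OF measurable_snd this] show ?thesis by (simp add: split_beta)
qed

lemma measurable_pair_sum_Nlf: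
  fixes f :: "(real ^ 'n) \<times> (real ^ 'n) \<times> (real ^ 'n) set \<Rightarrow> ennreal"
  assumes f: "f \<in> borel_measurable (borel \<Otimes>\<^sub>M borel \<Otimes>\<^sub>M Nlf)"
  shows "(\<lambda>x. \<integral>\<^sup>+u. (\<integral>\<^sup>+v. f (u, v, x - {u} - {v}) \<partial>count_space (x - {u})) \<partial>count_space x) \<in> borel_measurable Nlf"
proof -
  have "(\<lambda>z :: (real ^ 'n) \<times> (real ^ 'n) set. (fst z, snd z - {fst z})) \<in> measurable (borel \<Otimes>\<^sub>M Nlf) (borel \<Otimes>\<^sub>M Nlf)"
    by (intro measurable_Pair measurable_fst measurable_delete_point[unfolded split_beta])
  from measurable_compose[OF this measurable_sum_delete_point[OF f]]
  have "(\<lambda>z :: (real ^ 'n) \<times> (real ^ 'n) set. \<integral>\<^sup>+v. f (fst z, v, snd z - {fst z} - {v}) \<partial>count_space (snd z - {fst z}))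
      \<in> borel_measurable (borel \<Otimes>\<^sub>M Nlf)"
    by simp
  from measurable_sum_Nlf[OF measurable_ident this] show ?thesis by simp
qed

text \<open>The first application produces the factor \<open>ci u (X \<omega>)\<close> while
  \<open>v\<close> still ranges over \<open>X \<omega>\<close>. Once this factor is written in terms
  of \<open>v\<close> and the configuration without \<open>v\<close>, the identity applies again;
  \<open>v\<close> then becomes a point added to \<open>X \<omega>\<close>, whence
  \<open>insert v (X \<omega>)\<close>.\<close>

lemma papangelou_second_order:
  fixes X :: "'w \<Rightarrow> (real ^ 'n) set" and f :: "(real ^ 'n) \<times> (real ^ 'n) \<times> (real ^ 'n) set \<Rightarrow> ennreal"
  assumes process: "point_process M X" and intensity: "papangelou_intensity M X ci"
    and f[measurable]: "f \<in> borel_measurable (borel \<Otimes>\<^sub>M borel \<Otimes>\<^sub>M Nlf)"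
  shows "(\<integral>\<^sup>+\<omega>. (\<integral>\<^sup>+u. (\<integral>\<^sup>+v. f (u, v, X \<omega> - {u} - {v}) \<partial>count_space (X \<omega> - {u})) \<partial>count_space (X \<omega>)) \<partial>M)
    = (\<integral>\<^sup>+u. (\<integral>\<^sup>+v. (\<integral>\<^sup>+\<omega>. f (u, v, X \<omega>) * ennreal (ci u (insert v (X \<omega>))) * ennreal (ci v (X \<omega>)) \<partial>M) \<partial>lborel) \<partial>lborel)"
proof -
  note [measurable] = measurable_delete_point measurable_insert_point
  have X[measurable]: "X \<in> measurable M Nlf" using process by (simp add: point_process_def)
  have ci[measurable]: "(\<lambda>(u, x). ci u x) \<in> borel_measurable (borel \<Otimes>\<^sub>M Nlf)"
    and mecke: "\<And>h :: real ^ 'n \<Rightarrow> _ \<Rightarrow> ennreal. (\<lambda>(u, x). h u x) \<in> borel_measurable (borel \<Otimes>\<^sub>M Nlf) \<Longrightarrow>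
      (\<integral>\<^sup>+\<omega>. (\<integral>\<^sup>+u. h u (X \<omega> - {u}) \<partial>count_space (X \<omega>)) \<partial>M)
          = (\<integral>\<^sup>+u. (\<integral>\<^sup>+\<omega>. h u (X \<omega>) * ennreal (ci u (X \<omega>)) \<partial>M) \<partial>lborel)"
    using intensity by (auto simp: papangelou_intensity_def)
  define h where "h u x = (\<integral>\<^sup>+v. f (u, v, x - {v}) \<partial>count_space x)" for u x
  have h: "(\<lambda>(u, x). h u x) \<in> borel_measurable (borel \<Otimes>\<^sub>M Nlf)"
    unfolding h_def by (rule measurable_sum_delete_point[OF f])
  have "(\<integral>\<^sup>+\<omega>. h u (X \<omega>) * ennreal (ci u (X \<omega>)) \<partial>M)
    = (\<integral>\<^sup>+v. (\<integral>\<^sup>+\<omega>. f (u, v, X \<omega>) * ennreal (ci u (insert v (X \<omega>))) * ennreal (ci v (X \<omega>)) \<partial>M) \<partial>lborel)" for u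
  proof -
    \<comment> \<open>For \<open>v\<close> in \<open>X \<omega>\<close>, deleting and reinserting
      \<open>v\<close> changes nothing, so the factor can move into the sum as a function of the
      reduced configuration.\<close>
    have "h u (X \<omega>) * ennreal (ci u (X \<omega>))
        = (\<integral>\<^sup>+v. f (u, v, X \<omega> - {v}) * ennreal (ci u (insert v (X \<omega> - {v}))) \<partial>count_space (X \<omega>))" for \<omega>
      unfolding h_def
      by (subst nn_integral_multc[symmetric]) (auto intro!: nn_integral_cong simp: insert_absorb)
    moreover have "(\<lambda>z. ci u (insert (fst z) (snd z))) \<in> borel_measurable (borel \<Otimes>\<^sub>M Nlf)"
    proof -
      have "(\<lambda>z. (u, insert (fst z) (snd z))) \<in> measurable (borel \<Otimes>\<^sub>M Nlf) (borel \<Otimes>\<^sub>M Nlf)"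
        by (intro measurable_Pair measurable_const measurable_insert_point[unfolded split_beta]) auto
      from measurable_compose[OF this ci] show ?thesis by simp
    qed
    then have "(\<lambda>(v, x). f (u, v, x) * ennreal (ci u (insert v x))) \<in> borel_measurable (borel \<Otimes>\<^sub>M Nlf)"
      by (simp add: split_beta)
    ultimately show ?thesis using mecke[of "\<lambda>v x. f (u, v, x) * ennreal (ci u (insert v x))"] by simp
  qed
  with mecke[OF h] show ?thesis by (simp add: h_def)
qed

section \<open>Polar coordinates\<close>

lemma sphere_surface_eq: "0 < d \<Longrightarrow> sphere_surface d = real d * unit_ball_vol (real d)"
proof -
  assume "0 < d"
  then have G: "Gamma (real d / 2 + 1) = real d / 2 * Gamma (real d / 2)"
    by (intro Gamma_plus1) (auto dest: nonpos_Ints_nonpos)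
  then show ?thesis
    using \<open>0 < d\<close> unfolding sphere_surface_def unit_ball_vol_def G by simp
qed

lemma prob_space_sphere_unif: "prob_space (sphere_unif :: (real ^ 'n) measure)"
  unfolding sphere_unif_def
proof (rule prob_space.prob_space_distr)
  have "0 < emeasure lborel (ball (0 :: real ^ 'n) 1)" by (simp add: emeasure_ball ennreal_zero_less_mult_iff)
  then show "prob_space (uniform_measure lborel (ball (0 :: real ^ 'n) 1))"
    by (intro prob_space_uniform_measure) (simp_all add: emeasure_ball less_imp_neq[OF unit_ball_vol_pos, symmetric])
qed auto

lemma sets_sphere_unif [simp, measurable_cong]: "sets sphere_unif = sets borel"
  by (simp add: sphere_unif_def)

text \<open>The only value of \<open>sgn\<close> off the unit sphere is \<open>sgn 0 = 0\<close>,
  and the origin is a null set.\<close>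

lemma AE_sphere_unif: "AE z in (sphere_unif :: (real ^ 'n) measure). norm z = 1"
proof -
  have "AE z in uniform_measure lborel (ball (0 :: real ^ 'n) 1). norm (sgn z) = 1"
    using AE_lborel_singleton[of "0 :: real ^ 'n"]
    by (intro AE_uniform_measureI) (auto simp: norm_sgn)
  then show ?thesis unfolding sphere_unif_def by (subst AE_distr_iff) auto
qed

text \<open>A cone is invariant under dilations, so the volume of its part in a ball scales like the
  volume of the ball; at radius 1 the formula is the definition of \<open>sphere_unif\<close>.
  Radius 0 is separate because the dilation degenerates.\<close>

lemma emeasure_cone:
  assumes B: "B \<in> sets borel" and "0 \<le> x"
  shows "emeasure lborel (cball 0 x \<inter> sgn -` B :: (real ^ 'n) set)
    = ennreal (unit_ball_vol (real CARD('n)) * x ^ CARD('n)) * emeasure sphere_unif B"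
proof -
  have sB: "sgn -` B \<in> sets (borel :: (real ^ 'n) measure)"
    using measurable_sets[OF borel_measurable_sgn B] by simp
  let ?\<kappa> = "unit_ball_vol (real CARD('n))"
  have "emeasure sphere_unif B = emeasure (uniform_measure lborel (ball 0 1)) (sgn -` B :: (real ^ 'n) set)"
    unfolding sphere_unif_def using B by (subst emeasure_distr) auto
  also have "\<dots> = emeasure lborel (ball 0 1 \<inter> sgn -` B :: (real ^ 'n) set) / ennreal ?\<kappa>"
    using sB by (simp add: emeasure_ball)
  finally have S: "ennreal ?\<kappa> * emeasure sphere_unif B = emeasure lborel (ball 0 1 \<inter> sgn -` B :: (real ^ 'n) set)"
    using unit_ball_vol_pos[of "real CARD('n)"]
    by (simp add: ennreal_times_divide mult.commute[of "ennreal _"] del: unit_ball_vol_pos)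
       (rule ennreal_mult_divide_eq; simp add: less_imp_neq[OF unit_ball_vol_pos, symmetric])
  \<comment> \<open>\<open>sphere_unif\<close> comes from the open unit ball, whereas the cone is
    cut by a closed one; the bounding sphere is null.\<close>
  have unit: "emeasure lborel (ball 0 1 \<inter> sgn -` B :: (real ^ 'n) set) = emeasure lborel (cball 0 1 \<inter> sgn -` B :: (real ^ 'n) set)"
  proof (rule emeasure_eq_AE)
    have "sphere 0 1 \<in> null_sets (lborel :: (real ^ 'n) measure)"
      using negligible_sphere[of "0 :: real ^ 'n" 1]
      by (auto simp: null_sets_completion_iff negligible_iff_null_sets)
    from AE_not_in[OF this]
    show "AE w in lborel. w \<in> ball 0 1 \<inter> sgn -` B \<longleftrightarrow> w \<in> (cball 0 1 \<inter> sgn -` B :: (real ^ 'n) set)"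
      by eventually_elim auto
  qed (use sB in auto)
  show ?thesis
  proof (cases "x = 0")
    case True
    have "emeasure lborel (cball 0 x \<inter> sgn -` B :: (real ^ 'n) set) \<le> emeasure lborel {0 :: real ^ 'n}"
      using True by (intro emeasure_mono) auto
    with True show ?thesis by (simp add: zero_power)
  next
    case False
    with \<open>0 \<le> x\<close> have "0 < x" by simp
    have "emeasure lborel (cball 0 x \<inter> sgn -` B :: (real ^ 'n) set)
        = emeasure (density (distr lborel borel (\<lambda>w. 0 + x *\<^sub>R w)) (\<lambda>_. ennreal (\<bar>x\<bar> ^ DIM(real ^ 'n))))
           (cball 0 x \<inter> sgn -` B :: (real ^ 'n) set)"
      using lborel_affine[of x "0 :: real ^ 'n"] False by simp
    also have "\<dots> = ennreal (x ^ CARD('n)) * emeasure (distr lborel borel (\<lambda>w. 0 + x *\<^sub>R w)) (cball 0 x \<inter> sgn -` B :: (real ^ 'n) set)"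
      using sB \<open>0 < x\<close> by (subst emeasure_density_const) auto
    also have "emeasure (distr lborel borel (\<lambda>w. 0 + x *\<^sub>R w)) (cball 0 x \<inter> sgn -` B :: (real ^ 'n) set)
        = emeasure lborel (cball 0 1 \<inter> sgn -` B :: (real ^ 'n) set)"
    proof (subst emeasure_distr)
      have "(\<lambda>w. 0 + x *\<^sub>R w) -` (cball 0 x \<inter> sgn -` B) \<inter> space lborel = (cball 0 1 \<inter> sgn -` B :: (real ^ 'n) set)"
        using \<open>0 < x\<close> by (auto simp: sgn_scaleR)
      then show "emeasure lborel ((\<lambda>w. 0 + x *\<^sub>R w) -` (cball 0 x \<inter> sgn -` B) \<inter> space lborel)
         = emeasure lborel (cball 0 1 \<inter> sgn -` B :: (real ^ 'n) set)" by simp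
    qed (use sB in auto)
    also have "\<dots> = ennreal ?\<kappa> * emeasure sphere_unif B" using S unit by simp
    finally show ?thesis using \<open>0 < x\<close> by (simp add: ennreal_mult' mult_ac)
  qed
qed

text \<open>The density is the derivative of \<open>unit_ball_vol (real d) * t ^ d\<close>, the
  volume of a ball of radius \<open>t\<close>.\<close>

lemma nn_integral_radial_density:
  assumes "0 \<le> x" "x \<le> R" "0 < d"
  shows "(\<integral>\<^sup>+t. ennreal (sphere_surface d * t ^ (d - 1)) * indicator {x<..R} t \<partial>lborel)
    = ennreal (unit_ball_vol (real d) * (R ^ d - x ^ d))"
proof -
  have "(\<integral>\<^sup>+t. ennreal (sphere_surface d * t ^ (d - 1)) * indicator {x<..R} t \<partial>lborel)
    = (\<integral>\<^sup>+t. ennreal (sphere_surface d * t ^ (d - 1)) * indicator {x..R} t \<partial>lborel)"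
  proof (rule nn_integral_cong_AE)
    show "AE t in lborel. ennreal (sphere_surface d * t ^ (d - 1)) * indicator {x<..R} t
        = ennreal (sphere_surface d * t ^ (d - 1)) * indicator {x..R} t"
      using AE_lborel_singleton[of x] by eventually_elim (auto simp: indicator_def)
  qed
  also have "\<dots> = ennreal (unit_ball_vol (real d) * R ^ d - unit_ball_vol (real d) * x ^ d)"
  proof (rule nn_integral_FTC_Icc)
    fix t assume t: "t \<in> {x..R}"
    show "((\<lambda>t. unit_ball_vol (real d) * t ^ d) has_real_derivative sphere_surface d * t ^ (d - 1)) (at t)"
      using assms by (auto intro!: derivative_eq_intros simp: sphere_surface_eq)
    show "0 \<le> sphere_surface d * t ^ (d - 1)" using t assms by (simp add: sphere_surface_eq)
  qed (use assms in auto)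
  finally show ?thesis by (simp add: right_diff_distrib)
qed

text \<open>It suffices to compare rectangles. With \<open>B\<close> fixed, both sides become finite
  measures in \<open>A\<close>, finite because of the restriction to a ball, and these are compared
  on half-lines, where the volume of a conical shell is a difference of two cone volumes.\<close>

lemma polar_measure:
  fixes R :: real
  assumes "0 < R"
  shows "density lborel (\<lambda>t. ennreal (sphere_surface CARD('n) * t ^ (CARD('n) - 1)) * indicator {0<..R} t) \<Otimes>\<^sub>M sphere_unif
    = distr (density lborel (indicator (cball (0 :: real ^ 'n) R))) (borel \<Otimes>\<^sub>M borel) (\<lambda>w. (norm w, sgn w))"
    (is "?\<rho> \<Otimes>\<^sub>M _ = ?P")
proof (rule pair_measure_eqI)
  let ?\<kappa> = "unit_ball_vol (real CARD('n))"
  \<comment> \<open>Clamping \<open>x\<close> to the interval from 0 to \<open>R\<close> covers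
    negative thresholds and thresholds above \<open>R\<close> by one formula.\<close>
  have \<rho>: "emeasure ?\<rho> {x<..} = ennreal (?\<kappa> * (R ^ CARD('n) - max 0 (min R x) ^ CARD('n)))" for x
  proof -
    have "emeasure ?\<rho> {x<..} = (\<integral>\<^sup>+t. ennreal (sphere_surface CARD('n) * t ^ (CARD('n) - 1)) * indicator {max 0 (min R x)<..R} t \<partial>lborel)"
      by (subst emeasure_density) (auto intro!: nn_integral_cong simp: indicator_def)
    also have "\<dots> = ennreal (?\<kappa> * (R ^ CARD('n) - max 0 (min R x) ^ CARD('n)))"
      using assms by (intro nn_integral_radial_density) auto
    finally show ?thesis .
  qed
  have "emeasure ?\<rho> (space ?\<rho>) = emeasure ?\<rho> {0<..}"
    by (auto simp: emeasure_density intro!: nn_integral_cong split: split_indicator)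
  then show "sigma_finite_measure ?\<rho>"
    by (intro finite_measure.axioms finite_measureI) (simp only: \<rho>, simp)
  show "sigma_finite_measure (sphere_unif :: (real ^ 'n) measure)"
    using prob_space_sphere_unif by (intro finite_measure.axioms prob_space.finite_measure)
  show "sets (?\<rho> \<Otimes>\<^sub>M sphere_unif) = sets ?P"
    by (simp cong: sets_pair_measure_cong)
  fix A B assume "A \<in> sets ?\<rho>" "B \<in> sets (sphere_unif :: (real ^ 'n) measure)"
  then have A: "A \<in> sets borel" and B: "B \<in> sets borel" by auto
  then have sB[measurable]: "sgn -` B \<in> sets (borel :: (real ^ 'n) measure)"
    using measurable_sets[OF borel_measurable_sgn B] by simp
  have norm_vimage: "norm -` C \<in> sets (borel :: (real ^ 'n) measure)" if "C \<in> sets borel" for C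
    using measurable_sets[of norm borel borel C] that by simp
  let ?\<nu> = "distr (density lborel (indicator (cball 0 R \<inter> sgn -` B :: (real ^ 'n) set))) borel norm"
  let ?\<mu> = "scale_measure (emeasure sphere_unif B) ?\<rho>"
  have fin: "emeasure sphere_unif B < \<infinity>"
    using finite_measure.emeasure_finite[OF prob_space.finite_measure[OF prob_space_sphere_unif]]
    by (simp add: less_top)
  have "?\<nu> = ?\<mu>"
  proof (rule measure_eqI_lessThan)
    fix x :: real
    have pos: "\<not> 0 \<le> x \<Longrightarrow> x < norm w" for w :: "real ^ 'n"
      using norm_ge_zero[of w] by linarith
    let ?y = "max 0 (min R x)"
    let ?C = "\<lambda>y. cball 0 y \<inter> sgn -` B :: (real ^ 'n) set"
    have "?\<nu> {x<..} = emeasure (density lborel (indicator (?C R))) (norm -` {x<..})"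
      by (subst emeasure_distr) auto
    also have "\<dots> = emeasure lborel (?C R \<inter> norm -` {x<..})"
      using sB norm_vimage by (subst emeasure_restricted) auto
    also have "\<dots> = emeasure lborel (?C R - ?C ?y)"
    \<comment> \<open>For negative \<open>x\<close> the clamped radius is 0 and the set on the right
      may lose the origin, which is a null set; for other \<open>x\<close> the two sets
      coincide.\<close>
    proof (rule emeasure_eq_AE)
      show "AE w in lborel. w \<in> ?C R \<inter> norm -` {x<..} \<longleftrightarrow> w \<in> ?C R - ?C ?y"
        using AE_lborel_singleton[of "0 :: real ^ 'n"]
        by eventually_elim (use assms in \<open>auto simp: max_def min_def pos split: if_splits\<close>)
    qed (use sB norm_vimage in auto)
    also have "\<dots> = emeasure lborel (?C R) - emeasure lborel (?C ?y)"
      using sB assms fin by (intro emeasure_Diff) (auto simp: emeasure_cone[OF B] ennreal_mult_eq_top_iff)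
    also have "\<dots> = (ennreal (?\<kappa> * R ^ CARD('n)) - ennreal (?\<kappa> * ?y ^ CARD('n))) * emeasure sphere_unif B"
      using assms fin by (simp add: emeasure_cone[OF B] ennreal_right_diff_distrib mult.commute)
    also have "\<dots> = ?\<mu> {x<..}"
      using assms \<rho>[of x] by (simp add: ennreal_minus right_diff_distrib mult.commute)
    finally show eq: "?\<nu> {x<..} = ?\<mu> {x<..}" .
    show "?\<nu> {x<..} < \<infinity>" unfolding eq using fin \<rho>[of x] by (simp add: ennreal_mult_less_top)
  qed auto
  then have "?\<mu> A = ?\<nu> A" by simp
  also have "?\<nu> A = emeasure (density lborel (indicator (cball 0 R \<inter> sgn -` B :: (real ^ 'n) set))) (norm -` A)"
    using A by (subst emeasure_distr) auto
  also have "\<dots> = emeasure lborel (cball 0 R \<inter> sgn -` B \<inter> norm -` A :: (real ^ 'n) set)"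
    using sB norm_vimage[OF A] by (subst emeasure_restricted) auto
  also have "\<dots> = emeasure (density lborel (indicator (cball (0 :: real ^ 'n) R))) (norm -` A \<inter> sgn -` B)"
    using sB norm_vimage[OF A] by (subst emeasure_restricted)
      (auto intro!: arg_cong[where f = "emeasure lborel"])
  also have "\<dots> = emeasure ?P (A \<times> B)"
    using A B by (subst emeasure_distr) (auto simp: vimage_def Int_def)
  finally show "emeasure ?\<rho> A * emeasure sphere_unif B = emeasure ?P (A \<times> B)"
    by (simp add: mult.commute)
qed

lemma nn_integral_polar:
  fixes F :: "real ^ 'n \<Rightarrow> ennreal"
  assumes [measurable]: "F \<in> borel_measurable borel" and "0 < R"
  shows "(\<integral>\<^sup>+w. F w * indicator (cball 0 R) w \<partial>lborel)
    = (\<integral>\<^sup>+t. ennreal (sphere_surface CARD('n) * t ^ (CARD('n) - 1)) * indicator {0<..R} t *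
         (\<integral>\<^sup>+z. F (t *\<^sub>R z) \<partial>sphere_unif) \<partial>lborel)"
proof -
  interpret S: prob_space "sphere_unif :: (real ^ 'n) measure" by (rule prob_space_sphere_unif)
  let ?\<rho> = "density lborel (\<lambda>t. ennreal (sphere_surface CARD('n) * t ^ (CARD('n) - 1)) * indicator {0<..R} t)"
  have "(\<integral>\<^sup>+w. F w * indicator (cball 0 R) w \<partial>lborel) = (\<integral>\<^sup>+w. F w \<partial>density lborel (indicator (cball 0 R)))"
    by (subst nn_integral_density) (auto simp: mult.commute intro!: borel_measurable_indicator)
  also have "\<dots> = (\<integral>\<^sup>+w. F (norm w *\<^sub>R sgn w) \<partial>density lborel (indicator (cball 0 R)))"
  proof -
    have "norm w *\<^sub>R sgn w = w" for w :: "real ^ 'n"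
      by (cases "w = 0") (auto simp: sgn_div_norm)
    then show ?thesis by simp
  qed
  also have "\<dots> = (\<integral>\<^sup>+(t, z). F (t *\<^sub>R z)
      \<partial>distr (density lborel (indicator (cball 0 R))) (borel \<Otimes>\<^sub>M borel) (\<lambda>w. (norm w, sgn w)))"
    by (subst nn_integral_distr) auto
  also have "\<dots> = (\<integral>\<^sup>+(t, z). F (t *\<^sub>R z) \<partial>(?\<rho> \<Otimes>\<^sub>M sphere_unif))"
    by (simp only: polar_measure[OF \<open>0 < R\<close>])
  also have "\<dots> = (\<integral>\<^sup>+t. (\<integral>\<^sup>+z. F (t *\<^sub>R z) \<partial>sphere_unif) \<partial>?\<rho>)"
    by (subst S.nn_integral_fst[symmetric]) (auto cong: measurable_cong_sets)
  also have "\<dots> = (\<integral>\<^sup>+t. ennreal (sphere_surface CARD('n) * t ^ (CARD('n) - 1)) * indicator {0<..R} t *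
         (\<integral>\<^sup>+z. F (t *\<^sub>R z) \<partial>sphere_unif) \<partial>lborel)"
    by (subst nn_integral_density) auto
  finally show ?thesis .
qed

section \<open>Expectation of the estimator\<close>

text \<open>Local finiteness is essential: in a general set, points could approach distance
  \<open>R\<close> from outside, making the infimum equal to \<open>R\<close> although the closed
  ball is empty.\<close>

lemma h_tilde_eq:
  assumes "locally_finite x"
  shows "h_tilde R u x = of_bool (x \<inter> cball u R = {})"
proof (cases "x \<inter> cball u R = {}")
  case True
  then obtain m where m: "R < m" "\<And>p. p \<in> x \<Longrightarrow> m \<le> dist u p"
    using locally_finite_cball_gap[OF assms] by metis
  then have "ereal m \<le> dist_conf u x"
    unfolding dist_conf_def by (intro INF_greatest) (auto simp: dist_norm norm_minus_commute)
  with m(1) have "ereal R < dist_conf u x" by (meson ereal_less(2) less_ereal.simps(1) less_le_trans)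
  with True show ?thesis by (simp add: h_tilde_def)
next
  case False
  then obtain p where "p \<in> x" "dist u p \<le> R" by auto
  then have "dist_conf u x \<le> ereal R"
    unfolding dist_conf_def by (intro INF_lower2[of p]) (auto simp: dist_norm norm_minus_commute)
  with False show ?thesis by (auto simp: h_tilde_def)
qed

lemma measurable_h_tilde:
  assumes "0 \<le> R"
  shows "(\<lambda>(u :: real ^ 'n, x). h_tilde R u x) \<in> borel_measurable (borel \<Otimes>\<^sub>M Nlf)"
proof -
  note [measurable] = pred_meets_cball[OF assms]
  have "(\<lambda>(u :: real ^ 'n, x). of_bool (\<not> x \<inter> cball u R \<noteq> {}) :: real) \<in> borel_measurable (borel \<Otimes>\<^sub>M Nlf)"
    unfolding split_beta of_bool_def by measurable
  also have "?this \<longleftrightarrow> ?thesis"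
    by (intro measurable_cong) (auto simp: space_pair_measure h_tilde_eq)
  finally show ?thesis .
qed

lemma h_tilde_translation:
  assumes "locally_finite x"
  shows "h_tilde R u ((\<lambda>p. a + p) ` x) = h_tilde R (u - a) x"
proof -
  have "dist u (a + p) = dist (u - a) p" for p by (simp add: dist_norm algebra_simps)
  then have "(\<lambda>p. a + p) ` x \<inter> cball u R = {} \<longleftrightarrow> x \<inter> cball (u - a) R = {}"
    by (auto simp: disjoint_iff)
  then show ?thesis
    by (simp add: h_tilde_eq assms locally_finite_translation)
qed

lemma h_tilde_nonneg [simp]: "0 \<le> h_tilde R u x"
  by (simp add: h_tilde_def)

lemma h_tilde_le_1 [simp]: "h_tilde R u x \<le> 1"
  by (simp add: h_tilde_def)

lemma erosion_subset: "erosion W \<rho> \<subseteq> W"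
  by (auto simp: erosion_def)

text \<open>The erosion is an intersection of translates of \<open>W\<close>. Closedness is what
  makes the eroded window a Borel set.\<close>

lemma closed_erosion:
  assumes "closed W" "0 \<le> \<rho>"
  shows "closed (erosion W \<rho>)"
proof -
  have "erosion W \<rho> = (\<Inter>z\<in>cball 0 \<rho>. (\<lambda>u. u + z) -` W)"
  proof (intro set_eqI iffI)
    fix u assume "u \<in> erosion W \<rho>"
    then show "u \<in> (\<Inter>z\<in>cball 0 \<rho>. (\<lambda>u. u + z) -` W)"
      by (auto simp: erosion_def dist_norm)
  next
    fix u assume u: "u \<in> (\<Inter>z\<in>cball 0 \<rho>. (\<lambda>u. u + z) -` W)"
    have "p \<in> W" if "dist u p \<le> \<rho>" for p
      using u that by (auto dest!: bspec[of _ _ "p - u"] simp: dist_norm norm_minus_commute)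
    with assms(2) show "u \<in> erosion W \<rho>" by (auto simp: erosion_def)
  qed
  also have "closed \<dots>"
    by (intro closed_INT ballI continuous_closed_vimage assms continuous_intros)
  finally show ?thesis .
qed

text \<open>The first point is confined to the bounded set \<open>E\<close> and the second to a ball
  around it, so the \<open>infsum\<close> is a finite sum and no question of summability arises. The
  distance restriction moves from the index set into the integrand.\<close>

lemma infsum_pairs_eq_nn_integral:
  fixes x E :: "(real ^ 'n) set"
  assumes lf: "locally_finite x" and E: "bounded E"
    and nonneg: "\<And>u v. 0 \<le> g u v" and supp: "\<And>u v. u \<notin> E \<Longrightarrow> g u v = 0"
  shows "ennreal (\<Sum>\<^sub>\<infinity>(u, v)\<in>{(u, v). u \<in> x \<and> v \<in> x \<and> u \<noteq> v \<and> norm (v - u) \<le> R}. g u v)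
    = (\<integral>\<^sup>+u. (\<integral>\<^sup>+v. ennreal (of_bool (norm (v - u) \<le> R) * g u v) \<partial>count_space (x - {u})) \<partial>count_space x)"
proof -
  have supp': "u \<in> E" if "g u v \<noteq> 0" for u v using supp that by blast
  define G where "G u = x \<inter> cball u R - {u}" for u
  have fin: "finite (x \<inter> E)" "finite (G u)" for u
    using locally_finiteD[OF lf E] locally_finiteD[OF lf bounded_cball] by (auto simp: G_def)
  have "(\<Sum>\<^sub>\<infinity>(u, v)\<in>{(u, v). u \<in> x \<and> v \<in> x \<and> u \<noteq> v \<and> norm (v - u) \<le> R}. g u v)
      = (\<Sum>\<^sub>\<infinity>(u, v)\<in>Sigma (x \<inter> E) G. g u v)"
    by (intro infsum_cong_neutral) (auto simp: G_def dist_norm norm_minus_commute supp intro: supp')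
  also have "\<dots> = (\<Sum>u\<in>x \<inter> E. \<Sum>v\<in>G u. g u v)"
    using fin by (simp add: sum.Sigma finite_SigmaI)
  finally have "ennreal (\<Sum>\<^sub>\<infinity>(u, v)\<in>{(u, v). u \<in> x \<and> v \<in> x \<and> u \<noteq> v \<and> norm (v - u) \<le> R}. g u v)
      = (\<Sum>u\<in>x \<inter> E. \<Sum>v\<in>G u. ennreal (g u v))"
    using nonneg by (simp add: sum_ennreal sum_nonneg)
  also have "\<dots> = (\<Sum>u\<in>x \<inter> E. \<integral>\<^sup>+v. ennreal (of_bool (norm (v - u) \<le> R) * g u v) \<partial>count_space (x - {u}))"
  proof (intro sum.cong refl)
    fix u
    have "(\<integral>\<^sup>+v. ennreal (of_bool (norm (v - u) \<le> R) * g u v) \<partial>count_space (x - {u}))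
      = (\<Sum>v\<in>G u. ennreal (of_bool (norm (v - u) \<le> R) * g u v))"
      using fin by (intro nn_integral_count_space') (auto simp: G_def dist_norm norm_minus_commute)
    also have "\<dots> = (\<Sum>v\<in>G u. ennreal (g u v))"
      by (intro sum.cong) (auto simp: G_def dist_norm norm_minus_commute)
    finally show "(\<Sum>v\<in>G u. ennreal (g u v))
      = (\<integral>\<^sup>+v. ennreal (of_bool (norm (v - u) \<le> R) * g u v) \<partial>count_space (x - {u}))" by simp
  qed
  also have "\<dots> = (\<integral>\<^sup>+u. (\<integral>\<^sup>+v. ennreal (of_bool (norm (v - u) \<le> R) * g u v) \<partial>count_space (x - {u})) \<partial>count_space x)"
    using fin by (intro nn_integral_count_space'[symmetric]) (auto simp: supp)
  finally show ?thesis .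
qed

text \<open>The summand of the estimator with the reduced configuration as an argument of its own,
  which is the shape that \<open>papangelou_second_order\<close> requires.\<close>

definition pair_weight ::
    "(real \<Rightarrow> real) \<Rightarrow> real \<Rightarrow> real \<Rightarrow> (real ^ 'n) set \<Rightarrow> real \<Rightarrow> (real ^ 'n) \<times> (real ^ 'n) \<times> (real ^ 'n) set \<Rightarrow> real"
  where "pair_weight K R b E r = (\<lambda>(u, v, x). of_bool (norm (v - u) \<le> R) *
    (indicator E u / norm (v - u) ^ (CARD('n) - 1) * h_tilde R u x * h_tilde R v x *
      K ((norm (v - u) - r) / b)))"

lemma measurable_pair_weight [measurable]:
  fixes E :: "(real ^ 'n) set"
  assumes [measurable]: "E \<in> sets borel" "K \<in> borel_measurable borel" and "0 \<le> R"
  shows "pair_weight K R b E r \<in> borel_measurable (borel \<Otimes>\<^sub>M borel \<Otimes>\<^sub>M Nlf)"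
proof -
  let ?N = "(borel :: (real ^ 'n) measure) \<Otimes>\<^sub>M (borel :: (real ^ 'n) measure) \<Otimes>\<^sub>M (Nlf :: (real ^ 'n) set measure)"
  have [measurable]: "(\<lambda>z. h_tilde R (fst z) (snd (snd z))) \<in> borel_measurable ?N"
    "(\<lambda>z. h_tilde R (fst (snd z)) (snd (snd z))) \<in> borel_measurable ?N"
    using measurable_compose[OF _ measurable_h_tilde, of "\<lambda>z. (fst z, snd (snd z))" ?N]
      measurable_compose[OF _ measurable_h_tilde, of "\<lambda>z. (fst (snd z), snd (snd z))" ?N] \<open>0 \<le> R\<close>
    by (auto simp: split_beta)
  show ?thesis
    unfolding pair_weight_def split_beta of_bool_def by measurable
qed

section \<open>The pairwise interaction process and its expected pair sum\<close>

locale pairwise_interaction_process =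
  fixes M :: "'w measure" and X :: "'w \<Rightarrow> (real ^ 'n) set" and \<beta> R :: real and \<gamma> :: "real \<Rightarrow> real"
  assumes process: "point_process M X" and stationary: "stationary M X"
    and intensity: "papangelou_intensity M X (pairwise_intensity \<beta> \<gamma>)"
    and beta_pos: "0 < \<beta>" and R_pos: "0 < R"
    and gamma_pos: "\<And>t. 0 \<le> t \<Longrightarrow> t \<le> R \<Longrightarrow> 0 < \<gamma> t"
    and gamma_range: "\<And>t. R < t \<Longrightarrow> \<gamma> t = 0"
begin

sublocale prob_space M
  using process by (simp add: point_process_def)

lemma X_measurable [measurable]: "X \<in> measurable M Nlf"
  using process by (simp add: point_process_def)

lemma X_locally_finite: "\<omega> \<in> space M \<Longrightarrow> locally_finite (X \<omega>)"
  using measurable_space[OF X_measurable] by simp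

lemma intensity_empty_ball:
  fixes x :: "(real ^ 'n) set"
  assumes "x \<inter> cball v R = {}"
  shows "pairwise_intensity \<beta> \<gamma> v x = \<beta>"
proof -
  have "(\<Sum>\<^sub>\<infinity>w\<in>x - {v}. \<gamma> (norm (w - v))) = 0"
    using assms by (intro infsum_0 gamma_range) (auto simp: disjoint_iff dist_norm norm_minus_commute not_le)
  then show ?thesis by (simp add: pairwise_intensity_def)
qed

text \<open>Every point of \<open>x\<close> is out of the interaction range of \<open>u\<close>, so
  only the term of the added point survives.\<close>

lemma intensity_insert_empty_ball:
  fixes x :: "(real ^ 'n) set"
  assumes "x \<inter> cball u R = {}" "u \<noteq> v"
  shows "pairwise_intensity \<beta> \<gamma> u (insert v x) = \<beta> * exp (- \<gamma> (norm (v - u)))"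
proof -
  have "(\<Sum>\<^sub>\<infinity>w\<in>insert v x - {u}. \<gamma> (norm (w - u))) = (\<Sum>\<^sub>\<infinity>w\<in>{v}. \<gamma> (norm (w - u)))"
    using assms by (intro infsum_cong_neutral gamma_range) (auto simp: disjoint_iff dist_norm norm_minus_commute not_le)
  then show ?thesis by (simp add: pairwise_intensity_def)
qed

text \<open>The joint measurability of the conditional intensity is evaluated at the one-point
  configuration \<open>{0}\<close> along a ray: at distance \<open>t\<close> it equals
  \<open>\<beta> * exp (- \<gamma> t)\<close>. At \<open>t = 0\<close> the point of the
  configuration is itself removed from the sum, and negative \<open>t\<close> only show
  \<open>\<gamma>\<close> at the absolute value, hence the indicator.\<close>

lemma exp_gamma_measurable: "(\<lambda>t. indicator {0<..} t * exp (- \<gamma> t)) \<in> borel_measurable borel"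
proof -
  obtain e :: "real ^ 'n" where e: "norm e = 1" using vector_choose_size[of 1] by auto
  have "locally_finite {0 :: real ^ 'n}" by (simp add: locally_finite_def)
  then have "(\<lambda>t :: real. (t *\<^sub>R e, {0 :: real ^ 'n})) \<in> measurable borel (borel \<Otimes>\<^sub>M Nlf)"
    by (intro measurable_Pair measurable_const) auto
  from measurable_compose[OF this, of "\<lambda>(u, x). pairwise_intensity \<beta> \<gamma> u x"] intensity
  have "(\<lambda>t. pairwise_intensity \<beta> \<gamma> (t *\<^sub>R e) {0}) \<in> borel_measurable borel"
    by (simp add: papangelou_intensity_def)
  then have "(\<lambda>t. indicator {0<..} t * (pairwise_intensity \<beta> \<gamma> (t *\<^sub>R e) {0} / \<beta>)) \<in> borel_measurable borel"
    by measurable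
  also have "(\<lambda>t. indicator {0<..} t * (pairwise_intensity \<beta> \<gamma> (t *\<^sub>R e) {0} / \<beta>)) = (\<lambda>t. indicator {0<..} t * exp (- \<gamma> t))"
  proof
    fix t :: real
    have "{0} - {t *\<^sub>R e} = {0}" if "0 < t" using that e by auto
    then show "indicator {0<..} t * (pairwise_intensity \<beta> \<gamma> (t *\<^sub>R e) {0} / \<beta>) = indicator {0<..} t * exp (- \<gamma> t)"
      using e beta_pos by (auto simp: indicator_def pairwise_intensity_def)
  qed
  finally show ?thesis .
qed

lemma h_tilde_X_measurable [measurable]:
  "(\<lambda>z. h_tilde R (fst z) (X (snd z))) \<in> borel_measurable (borel \<Otimes>\<^sub>M M)"
  "(\<lambda>\<omega>. h_tilde R u (X \<omega>)) \<in> borel_measurable M"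
  using measurable_compose[OF _ measurable_h_tilde[of R], of "\<lambda>z. (fst z, X (snd z))" "borel \<Otimes>\<^sub>M M"]
    measurable_compose[OF _ measurable_h_tilde[of R], of "\<lambda>\<omega>. (u, X \<omega>)" M] R_pos
  by auto

abbreviation "F \<equiv> F_tilde M X R"
abbreviation "J \<equiv> J_fun M X R"

lemma h_tilde_integrable: "integrable M (\<lambda>\<omega>. h_tilde R u (X \<omega>) * h_tilde R v (X \<omega>))"
  by (rule integrable_const_bound[of _ 1]) (auto intro!: AE_I2 mult_le_one simp: abs_mult)

lemma F_nonneg: "0 \<le> F u v"
  unfolding F_tilde_def by (rule Bochner_Integration.integral_nonneg) simp

lemma F_le_1: "F u v \<le> 1"
  unfolding F_tilde_def
  by (rule integral_le_const[OF h_tilde_integrable]) (auto intro!: AE_I2 mult_le_one)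

lemma nn_integral_h_tilde: "(\<integral>\<^sup>+\<omega>. ennreal (h_tilde R u (X \<omega>) * h_tilde R v (X \<omega>)) \<partial>M) = ennreal (F u v)"
  unfolding F_tilde_def by (rule nn_integral_eq_integral[OF h_tilde_integrable]) (auto intro!: AE_I2)

lemma F_translation: "F u v = F 0 (v - u)"
proof -
  have mh: "(\<lambda>x. h_tilde R u x * h_tilde R v x) \<in> borel_measurable Nlf"
    using measurable_compose[OF _ measurable_h_tilde[of R], of "\<lambda>x. (u, x)" Nlf]
      measurable_compose[OF _ measurable_h_tilde[of R], of "\<lambda>x. (v, x)" Nlf] R_pos by simp
  have mX: "(\<lambda>\<omega>. (\<lambda>p. u + p) ` X \<omega>) \<in> measurable M Nlf"
    by (rule measurable_compose[OF X_measurable measurable_translation_Nlf])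
  have "F u v = (\<integral>x. h_tilde R u x * h_tilde R v x \<partial>distr M Nlf X)"
    unfolding F_tilde_def by (rule integral_distr[symmetric]) (use mh in auto)
  also have "\<dots> = (\<integral>x. h_tilde R u x * h_tilde R v x \<partial>distr M Nlf (\<lambda>\<omega>. (\<lambda>p. u + p) ` X \<omega>))"
    using stationary by (simp add: stationary_def)
  also have "\<dots> = (\<integral>\<omega>. h_tilde R u ((\<lambda>p. u + p) ` X \<omega>) * h_tilde R v ((\<lambda>p. u + p) ` X \<omega>) \<partial>M)"
    by (rule integral_distr[OF mX mh])
  also have "\<dots> = F 0 (v - u)"
    unfolding F_tilde_def
    by (intro Bochner_Integration.integral_cong) (auto simp: h_tilde_translation X_locally_finite)
  finally show ?thesis .
qed

lemma F_measurable [measurable]: "F 0 \<in> borel_measurable borel"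
  unfolding F_tilde_def
  by (rule borel_measurable_lebesgue_integral) (simp add: split_beta)

lemma J_nonneg: "0 \<le> J t"
  unfolding J_fun_def by (rule Bochner_Integration.integral_nonneg) (simp add: F_nonneg)

lemma F_sphere_integrable: "integrable sphere_unif (\<lambda>z. F 0 (t *\<^sub>R z))"
proof -
  interpret S: prob_space "sphere_unif :: (real ^ 'n) measure" by (rule prob_space_sphere_unif)
  show ?thesis
    by (rule S.integrable_const_bound[of _ 1])
      (auto intro!: AE_I2 simp: F_nonneg F_le_1 cong: measurable_cong_sets)
qed

lemma nn_integral_sphere_F: "(\<integral>\<^sup>+z. ennreal (F 0 (t *\<^sub>R z)) \<partial>sphere_unif) = ennreal (J t)"
  unfolding J_fun_def by (rule nn_integral_eq_integral[OF F_sphere_integrable]) (auto intro!: AE_I2 simp: F_nonneg)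

lemma J_measurable [measurable]: "J \<in> borel_measurable borel"
proof -
  interpret S: prob_space "sphere_unif :: (real ^ 'n) measure" by (rule prob_space_sphere_unif)
  show ?thesis unfolding J_fun_def
    by (rule S.borel_measurable_lebesgue_integral) (auto simp: split_beta)
qed

text \<open>After the second-order identity, \<open>F_translation\<close> leaves an integrand that
  depends on \<open>u\<close> through \<open>indicator E u\<close> and otherwise only on
  \<open>v - u\<close>. The volume of \<open>E\<close> splits off, and polar coordinates for the
  difference leave an integral over the distance.\<close>

lemma nn_integral_pair_sum:
  fixes E :: "(real ^ 'n) set"
  assumes E: "E \<in> sets borel" and K: "K \<in> borel_measurable borel" "\<And>s. 0 \<le> K s"
  shows "(\<integral>\<^sup>+\<omega>. (\<integral>\<^sup>+u. (\<integral>\<^sup>+v. ennreal (pair_weight K R b E r (u, v, X \<omega> - {u} - {v}))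
        \<partial>count_space (X \<omega> - {u})) \<partial>count_space (X \<omega>)) \<partial>M)
    = emeasure lborel E * ennreal (\<beta>\<^sup>2 * sphere_surface CARD('n)) *
      (\<integral>\<^sup>+t. ennreal (indicator {0<..R} t * (K ((t - r) / b) * exp (- \<gamma> t) * J t)) \<partial>lborel)"
proof -
  note [measurable] = E K(1) exp_gamma_measurable
  let ?d = "CARD('n)"
  define k where "k w = of_bool (norm w \<le> R) / norm w ^ (?d - 1) * K ((norm w - r) / b)" for w :: "real ^ 'n"
  \<comment> \<open>The indicator puts the exponential into the form covered by
    \<open>exp_gamma_measurable\<close>; it alters the integrand only at the origin, a null
    set.\<close>
  define g where "g w = k w * (indicator {0<..} (norm w) * exp (- \<gamma> (norm w))) * F 0 w" for w :: "real ^ 'n"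
  have [measurable]: "k \<in> borel_measurable borel" unfolding k_def of_bool_def by measurable
  have k_nonneg: "0 \<le> k w" for w using K(2) by (simp add: k_def)
  have [measurable]: "g \<in> borel_measurable borel" unfolding g_def by measurable
  have g_nonneg: "0 \<le> g w" for w using k_nonneg by (simp add: g_def F_nonneg)
  let ?\<phi> = "pair_weight K R b E r"
  have \<phi>: "?\<phi> \<in> borel_measurable (borel \<Otimes>\<^sub>M borel \<Otimes>\<^sub>M Nlf)"
    using R_pos by (intro measurable_pair_weight) auto
  have \<phi>_eq: "?\<phi> (u, v, x) = indicator E u * k (v - u) * h_tilde R u x * h_tilde R v x" for u v x
    by (simp add: pair_weight_def k_def mult_ac)
  let ?ci = "pairwise_intensity \<beta> \<gamma>"
  have inner: "(\<integral>\<^sup>+\<omega>. ennreal (?\<phi> (u, v, X \<omega>)) * ennreal (?ci u (insert v (X \<omega>))) * ennreal (?ci v (X \<omega>)) \<partial>M)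
      = ennreal (indicator E u * \<beta>\<^sup>2 * g (v - u))" if "u \<noteq> v" for u v
  proof -
    let ?a = "indicator E u * k (v - u) * \<beta>\<^sup>2 * exp (- \<gamma> (norm (v - u)))"
    have "0 \<le> ?a" using k_nonneg by simp
    have "ennreal (?\<phi> (u, v, X \<omega>)) * ennreal (?ci u (insert v (X \<omega>))) * ennreal (?ci v (X \<omega>))
        = ennreal ?a * ennreal (h_tilde R u (X \<omega>) * h_tilde R v (X \<omega>))" if "\<omega> \<in> space M" for \<omega>
    \<comment> \<open>If both balls are empty, the two conditional intensities are explicit;
      otherwise one factor \<open>h_tilde\<close> is 0 and their values do not matter.\<close>
    proof (cases "X \<omega> \<inter> cball u R = {} \<and> X \<omega> \<inter> cball v R = {}")
      case True
      then show ?thesis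
        using X_locally_finite[OF that] \<open>u \<noteq> v\<close> beta_pos k_nonneg[of "v - u"]
        by (simp add: intensity_insert_empty_ball intensity_empty_ball h_tilde_eq \<phi>_eq
            ennreal_mult[symmetric] power2_eq_square mult_ac)
    next
      case False
      then show ?thesis
        using X_locally_finite[OF that] by (auto simp: h_tilde_eq \<phi>_eq)
    qed
    then have "(\<integral>\<^sup>+\<omega>. ennreal (?\<phi> (u, v, X \<omega>)) * ennreal (?ci u (insert v (X \<omega>))) * ennreal (?ci v (X \<omega>)) \<partial>M)
        = (\<integral>\<^sup>+\<omega>. ennreal ?a * ennreal (h_tilde R u (X \<omega>) * h_tilde R v (X \<omega>)) \<partial>M)"
      by (intro nn_integral_cong) simp
    also have "\<dots> = ennreal ?a * ennreal (F u v)"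
      by (subst nn_integral_cmult) (simp_all add: nn_integral_h_tilde)
    also have "\<dots> = ennreal (indicator E u * \<beta>\<^sup>2 * g (v - u))"
      using \<open>0 \<le> ?a\<close> \<open>u \<noteq> v\<close> F_translation[of u v]
      by (simp add: ennreal_mult'[symmetric] g_def F_nonneg mult_ac)
    finally show ?thesis .
  qed
  have "(\<integral>\<^sup>+\<omega>. (\<integral>\<^sup>+u. (\<integral>\<^sup>+v. ennreal (?\<phi> (u, v, X \<omega> - {u} - {v})) \<partial>count_space (X \<omega> - {u})) \<partial>count_space (X \<omega>)) \<partial>M)
      = (\<integral>\<^sup>+u. (\<integral>\<^sup>+v. (\<integral>\<^sup>+\<omega>. ennreal (?\<phi> (u, v, X \<omega>)) * ennreal (?ci u (insert v (X \<omega>)))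
        * ennreal (?ci v (X \<omega>)) \<partial>M) \<partial>lborel) \<partial>lborel)"
    by (rule papangelou_second_order[OF process intensity]) (use \<phi> in simp)
  also have "\<dots> = (\<integral>\<^sup>+u. (\<integral>\<^sup>+v. ennreal (indicator E u * \<beta>\<^sup>2 * g (v - u)) \<partial>lborel) \<partial>lborel)"
  proof (rule nn_integral_cong, rule nn_integral_cong_AE)
    \<comment> \<open>The formula for the intensity with an added point fails on the diagonal
      \<open>v = u\<close>, which is null for fixed \<open>u\<close>.\<close>
    fix u :: "real ^ 'n"
    show "AE v in lborel. (\<integral>\<^sup>+\<omega>. ennreal (?\<phi> (u, v, X \<omega>)) * ennreal (?ci u (insert v (X \<omega>))) * ennreal (?ci v (X \<omega>)) \<partial>M)
        = ennreal (indicator E u * \<beta>\<^sup>2 * g (v - u))"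
      using AE_lborel_singleton[of u] by eventually_elim (auto intro: inner)
  qed
  also have "\<dots> = (\<integral>\<^sup>+u. indicator E u * (ennreal (\<beta>\<^sup>2) * (\<integral>\<^sup>+w. ennreal (g w) \<partial>lborel)) \<partial>lborel)"
  proof (intro nn_integral_cong)
    fix u :: "real ^ 'n"
    have "(\<integral>\<^sup>+v. ennreal (g (v - u)) \<partial>lborel) = (\<integral>\<^sup>+w. ennreal (g (u + w - u)) \<partial>lborel)"
      by (subst lborel_distr_plus[of u, symmetric], subst nn_integral_distr) auto
    then show "(\<integral>\<^sup>+v. ennreal (indicator E u * \<beta>\<^sup>2 * g (v - u)) \<partial>lborel)
        = indicator E u * (ennreal (\<beta>\<^sup>2) * (\<integral>\<^sup>+w. ennreal (g w) \<partial>lborel))"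
      by (auto simp: indicator_def ennreal_mult' nn_integral_cmult)
  qed
  also have "\<dots> = emeasure lborel E * (ennreal (\<beta>\<^sup>2) * (\<integral>\<^sup>+w. ennreal (g w) \<partial>lborel))"
    by (subst nn_integral_multc) auto
  also have "(\<integral>\<^sup>+w. ennreal (g w) \<partial>lborel) = (\<integral>\<^sup>+w. ennreal (g w) * indicator (cball 0 R) w \<partial>lborel)"
    by (intro nn_integral_cong) (auto simp: g_def k_def indicator_def)
  also have "\<dots> = (\<integral>\<^sup>+t. ennreal (sphere_surface ?d * t ^ (?d - 1)) * indicator {0<..R} t *
         (\<integral>\<^sup>+z. ennreal (g (t *\<^sub>R z)) \<partial>sphere_unif) \<partial>lborel)"
    by (rule nn_integral_polar[OF _ R_pos]) simp
  also have "\<dots> = (\<integral>\<^sup>+t. ennreal (sphere_surface ?d) *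
      ennreal (indicator {0<..R} t * (K ((t - r) / b) * exp (- \<gamma> t) * J t)) \<partial>lborel)"
  proof (intro nn_integral_cong)
    fix t :: real
    let ?s = "sphere_surface ?d"
    have "0 \<le> ?s" by (simp add: sphere_surface_eq)
    \<comment> \<open>The radial factor \<open>t ^ (?d - 1)\<close> cancels the weight by which the
      estimator divides, so \<open>K\<close> ends up integrated without any power of
      \<open>t\<close>.\<close>
    have "ennreal (?s * t ^ (?d - 1)) * (\<integral>\<^sup>+z. ennreal (g (t *\<^sub>R z)) \<partial>(sphere_unif :: (real ^ 'n) measure))
        = ennreal ?s * ennreal (K ((t - r) / b) * exp (- \<gamma> t) * J t)" if t: "0 < t" "t \<le> R"
    proof -
      have "(\<integral>\<^sup>+z. ennreal (g (t *\<^sub>R z)) \<partial>(sphere_unif :: (real ^ 'n) measure))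
          = (\<integral>\<^sup>+z. ennreal (K ((t - r) / b) * exp (- \<gamma> t) / t ^ (?d - 1)) * ennreal (F 0 (t *\<^sub>R z)) \<partial>sphere_unif)"
      proof (rule nn_integral_cong_AE)
        show "AE z in (sphere_unif :: (real ^ 'n) measure). ennreal (g (t *\<^sub>R z))
            = ennreal (K ((t - r) / b) * exp (- \<gamma> t) / t ^ (?d - 1)) * ennreal (F 0 (t *\<^sub>R z))"
          using AE_sphere_unif
        proof eventually_elim
          fix z :: "real ^ 'n" assume "norm z = 1"
          with t have "g (t *\<^sub>R z) = K ((t - r) / b) * exp (- \<gamma> t) / t ^ (?d - 1) * F 0 (t *\<^sub>R z)"
            by (simp add: g_def k_def)
          then show "ennreal (g (t *\<^sub>R z)) = ennreal (K ((t - r) / b) * exp (- \<gamma> t) / t ^ (?d - 1)) * ennreal (F 0 (t *\<^sub>R z))"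
            using K(2) t by (simp add: ennreal_mult[symmetric] F_nonneg)
        qed
      qed
      also have "\<dots> = ennreal (K ((t - r) / b) * exp (- \<gamma> t) / t ^ (?d - 1)) * ennreal (J t)"
        by (subst nn_integral_cmult) (auto simp: nn_integral_sphere_F cong: measurable_cong_sets)
      finally show ?thesis
        using t K(2) \<open>0 \<le> ?s\<close> by (simp add: ennreal_mult[symmetric] J_nonneg)
    qed
    then show "ennreal (?s * t ^ (?d - 1)) * indicator {0<..R} t * (\<integral>\<^sup>+z. ennreal (g (t *\<^sub>R z)) \<partial>(sphere_unif :: (real ^ 'n) measure))
        = ennreal ?s * ennreal (indicator {0<..R} t * (K ((t - r) / b) * exp (- \<gamma> t) * J t))"
      by (auto simp: indicator_def)
  qed
  also have "\<dots> = ennreal (sphere_surface ?d) *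
      (\<integral>\<^sup>+t. ennreal (indicator {0<..R} t * (K ((t - r) / b) * exp (- \<gamma> t) * J t)) \<partial>lborel)"
  proof (rule nn_integral_cmult)
    \<comment> \<open>The inner indicator changes nothing on \<open>{0<..R}\<close> and makes
      \<open>exp_gamma_measurable\<close> applicable.\<close>
    have "(\<lambda>t. ennreal (indicator {0<..R} t * (K ((t - r) / b) * (indicator {0<..} t * exp (- \<gamma> t)) * J t))) \<in> borel_measurable lborel"
      by measurable
    also have "?this \<longleftrightarrow> (\<lambda>t. ennreal (indicator {0<..R} t * (K ((t - r) / b) * exp (- \<gamma> t) * J t))) \<in> borel_measurable lborel"
      by (intro measurable_cong) (auto simp: indicator_def)
    finally show "(\<lambda>t. ennreal (indicator {0<..R} t * (K ((t - r) / b) * exp (- \<gamma> t) * J t))) \<in> borel_measurable lborel" .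
  qed
  also have "ennreal (\<beta>\<^sup>2) * (ennreal (sphere_surface ?d) * I) = ennreal (\<beta>\<^sup>2 * sphere_surface ?d) * I" for I
    by (subst ennreal_mult') (simp_all add: mult.assoc)
  finally show ?thesis by (simp only: mult.assoc)
qed

text \<open>Both passages between real and non-negative integrals use \<open>enn2real\<close>. It is
  multiplicative and sends infinity to 0, as the Bochner integral does for non-integrable functions,
  so only measurability and sign have to be checked. The window volume and the sphere surface then
  cancel against the normalisation of the estimator.\<close>

lemma integral_R_hat:
  fixes W :: "(real ^ 'n) set"
  assumes W: "compact W" "0 < measure lborel (erosion W (2 * R))"
    and K: "K \<in> borel_measurable borel" "\<And>s. 0 \<le> K s" and b: "0 < b"
  shows "(\<integral>\<omega>. R_hat K R b W r (X \<omega>) \<partial>M)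
    = \<beta>\<^sup>2 / b * (\<integral>t. K ((t - r) / b) * (indicator {0<..R} t * (exp (- \<gamma> t) * J t)) \<partial>lborel)"
proof -
  let ?d = "CARD('n)"
  let ?E = "erosion W (2 * R)"
  let ?g = "\<lambda>x u v. indicator ?E u / norm (v - u) ^ (?d - 1) *
        h_tilde R u (x - {u, v}) * h_tilde R v (x - {u, v}) * K ((norm (v - u) - r) / b)"
  let ?sum = "\<lambda>x. \<Sum>\<^sub>\<infinity>(u, v)\<in>{(u, v). u \<in> x \<and> v \<in> x \<and> u \<noteq> v \<and> norm (v - u) \<le> R}. ?g x u v"
  let ?nn = "\<lambda>x. \<integral>\<^sup>+u. (\<integral>\<^sup>+v. ennreal (pair_weight K R b ?E r (u, v, x - {u} - {v}))
        \<partial>count_space (x - {u})) \<partial>count_space x"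
  let ?rhs = "\<lambda>t. K ((t - r) / b) * (indicator {0<..R} t * (exp (- \<gamma> t) * J t))"
  have "closed ?E" using W(1) R_pos by (intro closed_erosion compact_imp_closed) auto
  then have E: "bounded ?E" "?E \<in> sets borel"
    using bounded_subset[OF compact_imp_bounded[OF W(1)] erosion_subset] by auto
  have s: "0 < sphere_surface ?d" by (simp add: sphere_surface_eq)
  have nonneg: "0 \<le> ?sum x" for x by (rule infsum_nonneg) (auto simp: K(2))
  have sum_nn: "ennreal (?sum x) = ?nn x" if "locally_finite x" for x
    using infsum_pairs_eq_nn_integral[OF that E(1), of "?g x" R] K
    by (simp add: pair_weight_def Diff_insert2[symmetric] insert_commute)
  have nn_meas: "(\<lambda>\<omega>. ?nn (X \<omega>)) \<in> borel_measurable M"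
    using R_pos E(2) K(1)
    by (intro measurable_compose[OF X_measurable measurable_pair_sum_Nlf]) simp
  have "(\<integral>\<omega>. ?sum (X \<omega>) \<partial>M) = enn2real (\<integral>\<^sup>+\<omega>. ennreal (?sum (X \<omega>)) \<partial>M)"
  proof (rule integral_eq_nn_integral)
    \<comment> \<open>The estimator inherits measurability from the iterated sum in
      \<open>ennreal\<close>, with which it agrees on locally finite configurations.\<close>
    have "(\<lambda>\<omega>. enn2real (?nn (X \<omega>))) \<in> borel_measurable M" using nn_meas by measurable
    also have "?this \<longleftrightarrow> (\<lambda>\<omega>. ?sum (X \<omega>)) \<in> borel_measurable M"
      by (intro measurable_cong)
        (simp only: sum_nn[OF X_locally_finite, symmetric] enn2real_ennreal[OF nonneg])
    finally show "(\<lambda>\<omega>. ?sum (X \<omega>)) \<in> borel_measurable M" .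
  qed (rule AE_I2[OF nonneg])
  also have "(\<integral>\<^sup>+\<omega>. ennreal (?sum (X \<omega>)) \<partial>M) = (\<integral>\<^sup>+\<omega>. ?nn (X \<omega>) \<partial>M)"
    by (intro nn_integral_cong sum_nn X_locally_finite)
  also have "\<dots> = emeasure lborel ?E * ennreal (\<beta>\<^sup>2 * sphere_surface ?d) * (\<integral>\<^sup>+t. ennreal (?rhs t) \<partial>lborel)"
    by (subst nn_integral_pair_sum[OF E(2) K]) (simp add: mult_ac)
  also have "enn2real \<dots> = measure lborel ?E * (\<beta>\<^sup>2 * sphere_surface ?d) * enn2real (\<integral>\<^sup>+t. ennreal (?rhs t) \<partial>lborel)"
    using s by (simp add: enn2real_mult measure_def)
  also have "enn2real (\<integral>\<^sup>+t. ennreal (?rhs t) \<partial>lborel) = (\<integral>t. ?rhs t \<partial>lborel)"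
  proof (rule integral_eq_nn_integral[symmetric])
    note [measurable] = K(1) exp_gamma_measurable
    have "(\<lambda>t. K ((t - r) / b) * (indicator {0<..R} t * ((indicator {0<..} t * exp (- \<gamma> t)) * J t))) \<in> borel_measurable lborel"
      by measurable
    also have "?this \<longleftrightarrow> ?rhs \<in> borel_measurable lborel"
      by (intro measurable_cong) (auto simp: indicator_def)
    finally show "?rhs \<in> borel_measurable lborel" .
  qed (simp add: K J_nonneg)
  finally have "(\<integral>\<omega>. ?sum (X \<omega>) \<partial>M) = measure lborel ?E * (\<beta>\<^sup>2 * sphere_surface ?d) * (\<integral>t. ?rhs t \<partial>lborel)" .
  then show ?thesis
    unfolding R_hat_def using W(2) s by simp
qed

section \<open>Continuity of \<open>J\<close> and the jump of the interaction at
  \<open>R\<close>\<close>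

lemma AE_no_point_on_sphere:
  fixes w :: "real ^ 'n"
  shows "AE \<omega> in M. X \<omega> \<inter> sphere w R = {}"
proof -
  let ?h = "\<lambda>u (x :: (real ^ 'n) set). indicator (sphere w R) u :: ennreal"
  have [measurable]: "sphere w R \<in> sets borel" by (simp add: borel_closed)
  have null: "AE u in lborel. u \<notin> sphere w R"
    using negligible_sphere[of w R]
    by (intro AE_not_in) (auto simp: null_sets_completion_iff negligible_iff_null_sets)
  have h: "(\<lambda>(u, x). ?h u x) \<in> borel_measurable (borel \<Otimes>\<^sub>M Nlf)"
    unfolding split_beta by measurable
  then have "(\<integral>\<^sup>+\<omega>. (\<integral>\<^sup>+u. ?h u (X \<omega> - {u}) \<partial>count_space (X \<omega>)) \<partial>M)
      = (\<integral>\<^sup>+u. (\<integral>\<^sup>+\<omega>. ?h u (X \<omega>) * ennreal (pairwise_intensity \<beta> \<gamma> u (X \<omega>)) \<partial>M) \<partial>lborel)"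
    using intensity unfolding papangelou_intensity_def by blast
  \<comment> \<open>The expected number of points on the sphere is an integral over a Lebesgue null
    set, hence 0 whatever the size of the intensity.\<close>
  also have "\<dots> = (\<integral>\<^sup>+u. 0 \<partial>(lborel :: (real ^ 'n) measure))"
    using null by (intro nn_integral_cong_AE) (auto elim!: eventually_mono)
  finally have "(\<integral>\<^sup>+\<omega>. (\<integral>\<^sup>+u. indicator (sphere w R) u \<partial>count_space (X \<omega>)) \<partial>M) = 0" by simp
  moreover have "(\<lambda>\<omega>. \<integral>\<^sup>+u. indicator (sphere w R) u \<partial>count_space (X \<omega>)) \<in> borel_measurable M"
    using measurable_sum_Nlf[OF X_measurable, of "\<lambda>z. indicator (sphere w R) (fst z)"] by simp
  ultimately have "AE \<omega> in M. (\<integral>\<^sup>+u. indicator (sphere w R) u \<partial>count_space (X \<omega>)) = 0"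
    by (subst (asm) nn_integral_0_iff_AE) auto
  then show ?thesis
  proof eventually_elim
    fix \<omega> assume "(\<integral>\<^sup>+u. indicator (sphere w R) u \<partial>count_space (X \<omega>)) = 0"
    then have "AE u in count_space (X \<omega>). indicator (sphere w R) u = (0 :: ennreal)"
      by (subst (asm) nn_integral_0_iff_AE) auto
    then show "X \<omega> \<inter> sphere w R = {}"
      by (auto simp: AE_count_space indicator_def split: if_splits)
  qed
qed

text \<open>Off the null event of a point on the sphere, \<open>h_tilde\<close> is locally constant
  in its centre: an empty closed ball has a gap around it, and otherwise some point lies strictly
  inside. Dominated convergence with bound 1 does the rest.\<close>

lemma F_tendsto:
  fixes w :: "real ^ 'n"
  assumes "a \<longlonglongrightarrow> w"
  shows "(\<lambda>k. F 0 (a k)) \<longlonglongrightarrow> F 0 w"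
  unfolding F_tilde_def
proof (rule integral_dominated_convergence[where w = "\<lambda>_. 1"])
  show "AE \<omega> in M. (\<lambda>k. h_tilde R 0 (X \<omega>) * h_tilde R (a k) (X \<omega>)) \<longlonglongrightarrow> h_tilde R 0 (X \<omega>) * h_tilde R w (X \<omega>)"
    using AE_no_point_on_sphere[of w] AE_space
  proof eventually_elim
    fix \<omega> assume sphere: "X \<omega> \<inter> sphere w R = {}" and "\<omega> \<in> space M"
    then have lf: "locally_finite (X \<omega>)" by (simp add: X_locally_finite)
    have near: "eventually (\<lambda>k. dist w (a k) < \<epsilon>) sequentially" if "0 < \<epsilon>" for \<epsilon>
      using tendstoD[OF assms that] by (simp add: dist_commute)
    have "eventually (\<lambda>k. h_tilde R (a k) (X \<omega>) = h_tilde R w (X \<omega>)) sequentially"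
    proof (cases "X \<omega> \<inter> cball w R = {}")
      case True
      then obtain m where m: "R < m" "\<And>p. p \<in> X \<omega> \<Longrightarrow> m \<le> dist w p"
        using locally_finite_cball_gap[OF lf] by metis
      have "eventually (\<lambda>k. dist w (a k) < m - R) sequentially" using near m(1) by simp
      then show ?thesis
      proof eventually_elim
        fix k assume k: "dist w (a k) < m - R"
        have "R < dist (a k) p" if "p \<in> X \<omega>" for p
          using m(2)[OF that] k dist_triangle[of w p "a k"] by linarith
        with True show "h_tilde R (a k) (X \<omega>) = h_tilde R w (X \<omega>)"
          by (force simp: h_tilde_eq[OF lf])
      qed
    next
      case False
      with sphere obtain p where p: "p \<in> X \<omega>" "dist w p < R" by (fastforce simp: less_le)
      have "eventually (\<lambda>k. dist w (a k) < R - dist w p) sequentially" using near p(2) by simp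
      then show ?thesis
      proof eventually_elim
        fix k assume k: "dist w (a k) < R - dist w p"
        then have "dist (a k) p \<le> R" using dist_triangle3[of "a k" p w] by linarith
        with p False show "h_tilde R (a k) (X \<omega>) = h_tilde R w (X \<omega>)"
          by (auto simp: h_tilde_eq[OF lf])
      qed
    qed
    then show "(\<lambda>k. h_tilde R 0 (X \<omega>) * h_tilde R (a k) (X \<omega>)) \<longlonglongrightarrow> h_tilde R 0 (X \<omega>) * h_tilde R w (X \<omega>)"
      by (intro tendsto_mult tendsto_const tendsto_eventually)
  qed
qed (auto intro!: AE_I2 mult_le_one simp: abs_mult)

lemma J_isCont: "isCont J t"
proof (rule continuous_at_sequentiallyI)
  fix a assume a: "a \<longlonglongrightarrow> t"
  interpret S: prob_space "sphere_unif :: (real ^ 'n) measure" by (rule prob_space_sphere_unif)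
  show "(\<lambda>k. J (a k)) \<longlonglongrightarrow> J t"
    unfolding J_fun_def
  proof (rule integral_dominated_convergence[where w = "\<lambda>_. 1"])
    show "AE z in sphere_unif. (\<lambda>k. F 0 (a k *\<^sub>R z)) \<longlonglongrightarrow> F 0 (t *\<^sub>R z)"
      using a by (intro AE_I2 F_tendsto tendsto_scaleR tendsto_const)
  qed (auto intro!: AE_I2 simp: F_nonneg F_le_1 cong: measurable_cong_sets)
qed

text \<open>The limit from the right is 0 while \<open>\<gamma> R\<close> is positive. Thus a
  continuity point of \<open>\<gamma>\<close> in \<open>{0<..R}\<close> lies strictly below
  \<open>R\<close>.\<close>

lemma not_isCont_gamma_R: "\<not> isCont \<gamma> R"
proof
  assume "isCont \<gamma> R"
  then have "(\<gamma> \<longlongrightarrow> \<gamma> R) (at_right R)"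
    by (simp add: isCont_def filterlim_at_split)
  moreover have "(\<gamma> \<longlongrightarrow> 0) (at_right R)"
    by (rule tendsto_eventually) (auto simp: eventually_at_right_field gamma_range intro: exI[of _ "R + 1"])
  ultimately have "\<gamma> R = 0"
    using tendsto_unique trivial_limit_at_right_real by blast
  with gamma_pos[of R] R_pos show False by simp
qed

text \<open>To the right of \<open>R\<close> the product is \<open>J\<close> itself, so continuity
  equates \<open>J R\<close> with \<open>exp (- \<gamma> R) * J R\<close>, where the factor is not
  1.\<close>

lemma J_R_eq_0:
  assumes "isCont (\<lambda>t. exp (- \<gamma> t) * J t) R"
  shows "J R = 0"
proof -
  have "((\<lambda>t. exp (- \<gamma> t) * J t) \<longlongrightarrow> exp (- \<gamma> R) * J R) (at_right R)"
    using assms by (simp add: isCont_def filterlim_at_split)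
  moreover have "(J \<longlongrightarrow> J R) (at_right R)"
    using J_isCont[of R] by (simp add: isCont_def filterlim_at_split)
  then have "((\<lambda>t. exp (- \<gamma> t) * J t) \<longlongrightarrow> J R) (at_right R)"
    by (rule Lim_transform_eventually)
      (auto simp: eventually_at_right_field gamma_range intro: exI[of _ "R + 1"])
  ultimately have "exp (- \<gamma> R) * J R = J R"
    using tendsto_unique trivial_limit_at_right_real by blast
  moreover have "exp (- \<gamma> R) \<noteq> 1" using gamma_pos[of R] R_pos by simp
  ultimately show ?thesis by simp
qed

end

section \<open>Kernel smoothing\<close>

locale smoothing_kernel =
  fixes K :: "real \<Rightarrow> real" and c :: real
  assumes K_measurable [measurable]: "K \<in> borel_measurable borel"
    and K_nonneg: "\<And>s. 0 \<le> K s"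
    and K_integral: "(\<integral>s. K s \<partial>lborel) = 1"
    and K_support: "\<And>s. K s \<noteq> 0 \<Longrightarrow> \<bar>s\<bar> \<le> c"
begin

text \<open>A non-integrable function has Bochner integral 0 by default, so total mass 1 already
  implies integrability.\<close>

lemma K_integrable: "integrable lborel K"
  using K_integral not_integrable_integral_eq by fastforce

lemma K_integrable_mult:
  assumes [measurable]: "p \<in> borel_measurable borel" and bound: "\<And>s. \<bar>s\<bar> \<le> c \<Longrightarrow> \<bar>p s\<bar> \<le> B"
  shows "integrable lborel (\<lambda>s. K s * p s)"
proof (rule Bochner_Integration.integrable_bound)
  show "integrable lborel (\<lambda>s. K s * B)" using K_integrable by simp
  show "AE s in lborel. norm (K s * p s) \<le> norm (K s * B)"
  proof (intro AE_I2)
    fix s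
    show "norm (K s * p s) \<le> norm (K s * B)"
    proof (cases "K s = 0")
      case False
      with bound[OF K_support] have "\<bar>p s\<bar> \<le> \<bar>B\<bar>" by fastforce
      then show ?thesis by (simp add: abs_mult mult_left_mono)
    qed simp
  qed
qed simp

lemma K_integrable_power: "integrable lborel (\<lambda>s. K s * s ^ m)"
  by (rule K_integrable_mult[where B = "c ^ m"]) (auto simp: power_abs intro!: power_mono)

lemma scaled_integral:
  assumes "0 < b"
  shows "1 / b * (\<integral>t. K ((t - r) / b) * \<phi> t \<partial>lborel) = (\<integral>s. K s * \<phi> (r + b * s) \<partial>lborel)"
  using lborel_integral_real_affine[of b "\<lambda>t. K ((t - r) / b) * \<phi> t" r] assms by simp

text \<open>\<open>p\<close> is a model of \<open>\<phi>\<close> near \<open>r\<close> whose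
  smoothing is known exactly: a constant for mere convergence, a Taylor polynomial for the rate.
  Since \<open>K\<close> is a probability density supported in \<open>\<bar>s\<bar> \<le> c\<close>,
  a uniform error there passes to the integral unchanged.\<close>

lemma smoothing_error:
  assumes [measurable]: "\<phi> \<in> borel_measurable borel"
    and "0 < b"
    and p: "p \<in> borel_measurable borel" "integrable lborel (\<lambda>s. K s * p s)"
    and err: "\<And>s. \<bar>s\<bar> \<le> c \<Longrightarrow> \<bar>\<phi> (r + b * s) - p s\<bar> \<le> e"
  shows "\<bar>1 / b * (\<integral>t. K ((t - r) / b) * \<phi> t \<partial>lborel) - (\<integral>s. K s * p s \<partial>lborel)\<bar> \<le> e"
proof -
  note [measurable] = p(1)
  have int: "integrable lborel (\<lambda>s. K s * (\<phi> (r + b * s) - p s))"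
    by (rule K_integrable_mult[where B = e]) (auto intro: err)
  from Bochner_Integration.integrable_add[OF this p(2)]
  have "integrable lborel (\<lambda>s. K s * \<phi> (r + b * s))" by (simp add: algebra_simps)
  then have "(\<integral>s. K s * \<phi> (r + b * s) \<partial>lborel) - (\<integral>s. K s * p s \<partial>lborel)
      = (\<integral>s. K s * (\<phi> (r + b * s) - p s) \<partial>lborel)"
    using p(2) by (simp add: right_diff_distrib)
  also have "norm \<dots> \<le> (\<integral>s. K s * e \<partial>lborel)"
  proof (rule Bochner_Integration.integral_norm_bound_integral)
    fix s
    show "norm (K s * (\<phi> (r + b * s) - p s)) \<le> K s * e"
    proof (cases "K s = 0")
      case False
      then have "\<bar>\<phi> (r + b * s) - p s\<bar> \<le> e" by (intro err K_support)
      then show ?thesis using K_nonneg[of s] by (simp add: abs_mult mult_left_mono)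
    qed simp
  qed (use int K_integrable in auto)
  also have "\<dots> = e" using K_integral by simp
  finally show ?thesis by (simp only: scaled_integral[OF \<open>0 < b\<close>] real_norm_def)
qed

text \<open>A vanishing second moment would force the non-negative \<open>K\<close> to be 0 almost
  everywhere, against its total mass 1. So the moment condition for the exponent 2 cannot
  hold.\<close>

lemma second_moment_nonzero: "(\<integral>s. s\<^sup>2 * K s \<partial>lborel) \<noteq> 0"
proof
  assume "(\<integral>s. s\<^sup>2 * K s \<partial>lborel) = 0"
  moreover have "integrable lborel (\<lambda>s. s\<^sup>2 * K s)"
    using K_integrable_power[of 2] by (simp add: mult.commute)
  ultimately have "AE s in lborel. s\<^sup>2 * K s = 0"
    by (subst (asm) integral_nonneg_eq_0_iff_AE) (auto simp: K_nonneg)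
  then have "AE s in lborel. K s = 0"
    using AE_lborel_singleton[of 0] by eventually_elim auto
  then have "(\<integral>s. K s \<partial>lborel) = 0" by (intro integral_eq_zero_AE)
  with K_integral show False by simp
qed

text \<open>The moment conditions remove every term of positive degree below
  \<open>\<alpha>\<close>, so only the constant term survives smoothing.\<close>

lemma integral_polynomial:
  assumes "1 \<le> \<alpha>" and moments: "\<And>j. j \<in> {1..<\<alpha>} \<Longrightarrow> (\<integral>s. s ^ j * K s \<partial>lborel) = 0"
  shows "integrable lborel (\<lambda>s. K s * (\<Sum>m<\<alpha>. a m * (b * s) ^ m))"
    "(\<integral>s. K s * (\<Sum>m<\<alpha>. a m * (b * s) ^ m) \<partial>lborel) = a 0"
proof -
  have eq: "K s * (\<Sum>m<\<alpha>. a m * (b * s) ^ m) = (\<Sum>m<\<alpha>. (a m * b ^ m) * (K s * s ^ m))" for s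
    by (simp add: sum_distrib_left power_mult_distrib mult_ac)
  show "integrable lborel (\<lambda>s. K s * (\<Sum>m<\<alpha>. a m * (b * s) ^ m))"
    unfolding eq by (intro Bochner_Integration.integrable_sum integrable_mult_right K_integrable_power)
  have "(\<integral>s. K s * (\<Sum>m<\<alpha>. a m * (b * s) ^ m) \<partial>lborel) = (\<Sum>m<\<alpha>. (a m * b ^ m) * (\<integral>s. K s * s ^ m \<partial>lborel))"
    unfolding eq by (subst Bochner_Integration.integral_sum) (auto simp: K_integrable_power)
  also have "\<dots> = (\<Sum>m<\<alpha>. if m = 0 then a 0 else 0)"
  proof (intro sum.cong refl)
    fix m assume "m \<in> {..<\<alpha>}"
    then show "(a m * b ^ m) * (\<integral>s. K s * s ^ m \<partial>lborel) = (if m = 0 then a 0 else 0)"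
      using moments[of m] K_integral by (auto simp: mult.commute)
  qed
  also have "\<dots> = a 0" using assms(1) by simp
  finally show "(\<integral>s. K s * (\<Sum>m<\<alpha>. a m * (b * s) ^ m) \<partial>lborel) = a 0" .
qed

end

lemma condition_K_kernel:
  assumes "condition_K \<alpha> K b w"
  obtains c where "0 < c" "smoothing_kernel K c"
proof -
  have "bounded {u. K u \<noteq> 0}" using assms by (simp add: condition_K_def)
  then obtain c where "0 < c" "\<And>u. u \<in> {u. K u \<noteq> 0} \<Longrightarrow> norm u \<le> c" by (auto simp: bounded_pos)
  with assms that show ?thesis by (auto simp: condition_K_def smoothing_kernel_def)
qed

lemma Taylor_bound:
  assumes f: "bounded_continuous_deriv \<alpha> f {r - \<delta><..<r + \<delta>}" and "1 \<le> \<alpha>"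
  shows "\<exists>C\<ge>0. \<forall>h. \<bar>h\<bar> < \<delta> \<longrightarrow>
    \<bar>f (r + h) - (\<Sum>m<\<alpha>. (deriv ^^ m) f r / fact m * h ^ m)\<bar> \<le> C * \<bar>h\<bar> ^ \<alpha>"
proof -
  let ?I = "{r - \<delta><..<r + \<delta>}"
  have D: "((deriv ^^ m) f has_real_derivative deriv ((deriv ^^ m) f) t) (at t)" if "m < \<alpha>" "t \<in> ?I" for m t
    using f that by (auto simp: bounded_continuous_deriv_def DERIV_deriv_iff_real_differentiable)
  obtain B where B: "\<And>t. t \<in> ?I \<Longrightarrow> \<bar>(deriv ^^ \<alpha>) f t\<bar> \<le> B"
    using f by (fastforce simp: bounded_continuous_deriv_def bounded_iff)
  show ?thesis
  \<comment> \<open>This is the Lagrange remainder with the bound on the top derivative; the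
    absolute value makes the constant visibly non-negative.\<close>
  proof (intro exI[of _ "\<bar>B\<bar> / fact \<alpha>"] conjI allI impI)
    fix h :: real assume h: "\<bar>h\<bar> < \<delta>"
    have "\<exists>t\<in>?I. f (r + h) = (\<Sum>m<\<alpha>. (deriv ^^ m) f r / fact m * h ^ m) + (deriv ^^ \<alpha>) f t / fact \<alpha> * h ^ \<alpha>"
    proof (cases h "0 :: real" rule: linorder_cases)
      case less
      have "\<exists>t. r + h < t \<and> t < r \<and> f (r + h) = (\<Sum>m<\<alpha>. (deriv ^^ m) f r / fact m * (r + h - r) ^ m)
          + (deriv ^^ \<alpha>) f t / fact \<alpha> * (r + h - r) ^ \<alpha>"
        using less h \<open>1 \<le> \<alpha>\<close> by (intro Taylor_down[of _ "\<lambda>m. (deriv ^^ m) f" f "r + h" r r]) (auto intro!: D)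
      with less h show ?thesis by force
    next
      case equal
      \<comment> \<open>The convention \<open>0 ^ 0 = 1\<close> leaves exactly the constant
        term.\<close>
      have "(\<Sum>m<\<alpha>. (deriv ^^ m) f r / fact m * 0 ^ m) = (\<Sum>m<\<alpha>. if m = 0 then f r else 0)"
        by (intro sum.cong) auto
      with equal h \<open>1 \<le> \<alpha>\<close> show ?thesis by (intro bexI[of _ r]) auto
    next
      case greater
      have "\<exists>t. r < t \<and> t < r + h \<and> f (r + h) = (\<Sum>m<\<alpha>. (deriv ^^ m) f r / fact m * (r + h - r) ^ m)
          + (deriv ^^ \<alpha>) f t / fact \<alpha> * (r + h - r) ^ \<alpha>"
        using greater h \<open>1 \<le> \<alpha>\<close> by (intro Taylor_up[of _ "\<lambda>m. (deriv ^^ m) f" f r "r + h" r]) (auto intro!: D)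
      with greater h show ?thesis by force
    qed
    then obtain t where t: "t \<in> ?I"
      "f (r + h) - (\<Sum>m<\<alpha>. (deriv ^^ m) f r / fact m * h ^ m) = (deriv ^^ \<alpha>) f t / fact \<alpha> * h ^ \<alpha>"
      by auto
    have "\<bar>(deriv ^^ \<alpha>) f t\<bar> \<le> \<bar>B\<bar>" using B[OF t(1)] by simp
    then show "\<bar>f (r + h) - (\<Sum>m<\<alpha>. (deriv ^^ m) f r / fact m * h ^ m)\<bar> \<le> \<bar>B\<bar> / fact \<alpha> * \<bar>h\<bar> ^ \<alpha>"
      unfolding t(2) by (simp add: abs_mult power_abs mult_right_mono divide_right_mono)
  qed simp
qed

section \<open>Smoothing error for \<open>f\<close> cut off outside \<open>{0<..R}\<close>\<close>

context pairwise_interaction_process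
begin

abbreviation "f \<equiv> \<lambda>t. exp (- \<gamma> t) * J t"

lemma f_nonneg: "0 \<le> f t"
  by (simp add: J_nonneg)

lemma truncated_f_measurable: "(\<lambda>t. indicator {0<..R} t * f t) \<in> borel_measurable borel"
proof -
  note [measurable] = exp_gamma_measurable
  have "(\<lambda>t. indicator {0<..R} t * ((indicator {0<..} t * exp (- \<gamma> t)) * J t)) \<in> borel_measurable borel"
    by measurable
  also have "?this \<longleftrightarrow> ?thesis" by (intro measurable_cong) (auto simp: indicator_def)
  finally show ?thesis .
qed

text \<open>At \<open>r = R\<close> the estimator sees only half of the kernel. The statement survives because
  continuity of \<open>f\<close> at \<open>R\<close>, where \<open>\<gamma>\<close> jumps, forces \<open>J R = 0\<close>, and the non-negative \<open>f\<close>
  then has a minimum at \<open>R\<close>.\<close>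

lemma f_derivatives_vanish_at_R:
  assumes \<alpha>: "1 \<le> \<alpha>" "\<alpha> \<le> 2" and "0 < \<delta>"
    and f: "bounded_continuous_deriv \<alpha> f {R - \<delta><..<R + \<delta>}" and m: "m < \<alpha>"
  shows "(deriv ^^ m) f R = 0"
proof -
  have diff: "(deriv ^^ j) f differentiable (at R)" if "j < \<alpha>" for j
    using f that \<open>0 < \<delta>\<close> by (auto simp: bounded_continuous_deriv_def)
  have "isCont f R" using diff[of 0] \<alpha> differentiable_imp_continuous_within by fastforce
  then have J0: "J R = 0" by (rule J_R_eq_0)
  from m \<alpha> consider "m = 0" | "m = 1" by linarith
  then show ?thesis
  proof cases
    case 1
    with J0 show ?thesis by simp
  next
    case 2
    have "(f has_real_derivative deriv f R) (at R)"
      using diff[of 0] \<alpha> by (simp add: DERIV_deriv_iff_real_differentiable)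
    then have "deriv f R = 0"
      by (rule DERIV_local_min[where d = 1]) (auto simp: J0 f_nonneg J_nonneg)
    with 2 show ?thesis by simp
  qed
qed

text \<open>Where the cut-off is inactive this is Taylor's formula with
  \<open>\<bar>b * s\<bar> \<le> b * c\<close> on the support of \<open>K\<close>. The cut-off can
  only interfere for \<open>r = R\<close>, and there the Taylor polynomial is identically 0, so it
  matches the truncated function beyond \<open>R\<close>.\<close>

lemma truncated_f_error:
  assumes K: "smoothing_kernel K c" and \<alpha>: "1 \<le> \<alpha>"
    and moments: "\<And>j. j \<in> {1..<\<alpha>} \<Longrightarrow> (\<integral>s. s ^ j * K s \<partial>lborel) = 0"
    and r: "r \<in> {0<..R}" and "0 < \<delta>"
    and f: "bounded_continuous_deriv \<alpha> f {r - \<delta><..<r + \<delta>}"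
  shows "\<exists>C \<eta>. 0 < \<eta> \<and> 0 \<le> C \<and> (\<forall>b. 0 < b \<longrightarrow> b * c < \<eta> \<longrightarrow>
      \<bar>1 / b * (\<integral>t. K ((t - r) / b) * (indicator {0<..R} t * f t) \<partial>lborel) - f r\<bar> \<le> C * (b * c) ^ \<alpha>)"
proof -
  interpret smoothing_kernel K c by (rule K)
  obtain C where C: "0 \<le> C"
    "\<And>h. \<bar>h\<bar> < \<delta> \<Longrightarrow> \<bar>f (r + h) - (\<Sum>m<\<alpha>. (deriv ^^ m) f r / fact m * h ^ m)\<bar> \<le> C * \<bar>h\<bar> ^ \<alpha>"
    using Taylor_bound[OF f \<alpha>] by auto
  \<comment> \<open>Offsets below this threshold stay in the smooth neighbourhood and keep the
    argument positive; for \<open>r < R\<close> they also keep it below \<open>R\<close>. For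
    \<open>r = R\<close> the last entry repeats \<open>r\<close> and imposes nothing.\<close>
  define \<eta> where "\<eta> = min \<delta> (min r (if r = R then R else R - r))"
  have "0 < \<eta>" using r \<open>0 < \<delta>\<close> by (auto simp: \<eta>_def)
  let ?p = "\<lambda>b s. \<Sum>m<\<alpha>. (deriv ^^ m) f r / fact m * (b * s) ^ m"
  show ?thesis
  proof (intro exI conjI allI impI)
    fix b :: real assume b: "0 < b" "b * c < \<eta>"
    have "\<bar>1 / b * (\<integral>t. K ((t - r) / b) * (indicator {0<..R} t * f t) \<partial>lborel)
        - (\<integral>s. K s * ?p b s \<partial>lborel)\<bar> \<le> C * (b * c) ^ \<alpha>"
    proof (rule smoothing_error[OF truncated_f_measurable b(1)])
      show "integrable lborel (\<lambda>s. K s * ?p b s)" by (rule integral_polynomial(1)[OF \<alpha> moments])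
      fix s :: real assume s: "\<bar>s\<bar> \<le> c"
      then have "\<bar>b * s\<bar> \<le> b * c" using b(1) by (simp add: abs_mult)
      with b(2) have h: "\<bar>b * s\<bar> < \<delta>" "\<bar>b * s\<bar> < r" "r \<noteq> R \<Longrightarrow> \<bar>b * s\<bar> < R - r"
        by (auto simp: \<eta>_def)
      have "\<bar>b * s\<bar> ^ \<alpha> \<le> (b * c) ^ \<alpha>"
        using \<open>\<bar>b * s\<bar> \<le> b * c\<close> by (intro power_mono) auto
      then have le: "C * \<bar>b * s\<bar> ^ \<alpha> \<le> C * (b * c) ^ \<alpha>" using C(1) by (rule mult_left_mono)
      show "\<bar>indicator {0<..R} (r + b * s) * f (r + b * s) - ?p b s\<bar> \<le> C * (b * c) ^ \<alpha>"
      proof (cases "r + b * s \<le> R")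
        case True
        with h(2) have "indicator {0<..R} (r + b * s) = (1 :: real)" by (auto simp: indicator_def)
        then show ?thesis using C(2)[OF h(1)] le by simp
      next
        case False
        with h(3) have "r = R" by force
        \<comment> \<open>Larger orders would include the exponent 2 among the vanishing moments.
          Without this bound, derivatives of order 2 and above would have to vanish at
          \<open>R\<close>, which the minimum argument does not give.\<close>
        have "\<alpha> \<le> 2" using second_moment_nonzero moments[of 2] by fastforce
        have "(deriv ^^ m) f r = 0" if "m < \<alpha>" for m
          using f_derivatives_vanish_at_R[OF \<alpha> \<open>\<alpha> \<le> 2\<close> \<open>0 < \<delta>\<close> _ that] f \<open>r = R\<close> by simp
        then have "?p b s = 0" by simp
        with False C(1) s b(1) show ?thesis by (simp add: indicator_def)
      qed
    qed measurable
    also have "(\<integral>s. K s * ?p b s \<partial>lborel) = f r"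
      by (subst integral_polynomial(2)[OF \<alpha> moments]) auto
    finally show "\<bar>1 / b * (\<integral>t. K ((t - r) / b) * (indicator {0<..R} t * f t) \<partial>lborel) - f r\<bar> \<le> C * (b * c) ^ \<alpha>" .
  qed (fact \<open>0 < \<eta>\<close> C(1))+
qed

lemma truncated_f_tendsto:
  assumes K: "smoothing_kernel K c" and "0 < c" and r: "r \<in> {0<..R}" and cont: "isCont \<gamma> r"
    and b: "\<And>n. 0 < b n" "b \<longlonglongrightarrow> 0"
  shows "(\<lambda>n. 1 / b n * (\<integral>t. K ((t - r) / b n) * (indicator {0<..R} t * f t) \<partial>lborel)) \<longlonglongrightarrow> f r"
proof (rule LIMSEQ_I)
  interpret smoothing_kernel K c by (rule K)
  fix \<epsilon> :: real assume "0 < \<epsilon>"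
  \<comment> \<open>With \<open>r\<close> strictly inside, the cut-off is not felt once the scaled
    support of the kernel is short enough.\<close>
  have "r < R" using r cont not_isCont_gamma_R by (cases "r = R") auto
  have "isCont f r" using cont J_isCont[of r] by (intro continuous_intros) auto
  then obtain \<delta> where \<delta>: "0 < \<delta>" "\<And>t. dist t r < \<delta> \<Longrightarrow> dist (f t) (f r) < \<epsilon> / 2"
    using \<open>0 < \<epsilon>\<close> unfolding continuous_at_eps_delta by (metis half_gt_zero)
  define \<eta> where "\<eta> = min \<delta> (min r (R - r))"
  have "0 < \<eta>" using r \<open>r < R\<close> \<delta>(1) by (auto simp: \<eta>_def)
  then obtain N where "\<forall>n\<ge>N. norm (b n - 0) < \<eta> / c"
    using \<open>0 < c\<close> LIMSEQ_D[OF b(2), of "\<eta> / c"] by auto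
  then have "b n < \<eta> / c" if "N \<le> n" for n
    using that by force
  then have N: "b n * c < \<eta>" if "N \<le> n" for n
    using that \<open>0 < c\<close> by (simp add: pos_less_divide_eq)
  show "\<exists>N. \<forall>n\<ge>N. norm (1 / b n * (\<integral>t. K ((t - r) / b n) * (indicator {0<..R} t * f t) \<partial>lborel) - f r) < \<epsilon>"
  proof (intro exI allI impI)
    fix n assume "N \<le> n"
    \<comment> \<open>The model function is the constant \<open>f r\<close>. Half of
      \<open>\<epsilon>\<close> is used because the bound is non-strict while the limit asks for a
      strict one.\<close>
    have "\<bar>1 / b n * (\<integral>t. K ((t - r) / b n) * (indicator {0<..R} t * f t) \<partial>lborel) - (\<integral>s. K s * f r \<partial>lborel)\<bar> \<le> \<epsilon> / 2"
    proof (rule smoothing_error[OF truncated_f_measurable b(1)])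
      show "integrable lborel (\<lambda>s. K s * f r)" using K_integrable by simp
      fix s :: real assume "\<bar>s\<bar> \<le> c"
      then have "\<bar>b n * s\<bar> \<le> b n * c" using b(1)[of n] by (simp add: abs_mult)
      with N[OF \<open>N \<le> n\<close>] have h: "\<bar>b n * s\<bar> < \<delta>" "\<bar>b n * s\<bar> < r" "\<bar>b n * s\<bar> < R - r"
        by (auto simp: \<eta>_def)
      then have "indicator {0<..R} (r + b n * s) = (1 :: real)" by (auto simp: indicator_def)
      then show "\<bar>indicator {0<..R} (r + b n * s) * f (r + b n * s) - f r\<bar> \<le> \<epsilon> / 2"
        using \<delta>(2)[of "r + b n * s"] h(1) by (simp add: dist_real_def)
    qed simp
    then show "norm (1 / b n * (\<integral>t. K ((t - r) / b n) * (indicator {0<..R} t * f t) \<partial>lborel) - f r) < \<epsilon>"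
      using K_integral \<open>0 < \<epsilon>\<close> by simp
  qed
qed

end

theorem theorem1:
  fixes M :: "'w measure" and X :: "'w \<Rightarrow> (real ^ 'n) set"
    and \<beta> R :: real and \<gamma> K :: "real \<Rightarrow> real"
    and W :: "nat \<Rightarrow> (real ^ 'n) set" and b :: "nat \<Rightarrow> real"
  assumes process: "point_process M X" "stationary M X" "isotropic M X"
    and intensity: "papangelou_intensity M X (pairwise_intensity \<beta> \<gamma>)"
    and params: "0 < \<beta>" "0 < R"
    and gamma_pos: "\<And>t. 0 \<le> t \<Longrightarrow> t \<le> R \<Longrightarrow> 0 < \<gamma> t"
    and gamma_range: "\<And>t. R < t \<Longrightarrow> \<gamma> t = 0"
    and windows: "\<And>n. is_cube (W n)" "incseq W" "(\<Union>n. W n) = UNIV"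
      "\<And>n. 0 < measure lborel (erosion (W n) (2 * R))"
  shows
    "(condition_K 1 K b (\<lambda>n. measure lborel (erosion (W n) (2 * R))) \<longrightarrow>
        (\<forall>r\<in>{0<..R}. isCont \<gamma> r \<longrightarrow>
          (\<lambda>n. \<integral>\<omega>. R_hat K R (b n) (W n) r (X \<omega>) \<partial>M)
            \<longlonglongrightarrow> \<beta>\<^sup>2 * J_fun M X R r * exp (- \<gamma> r)))
     \<and>
     (\<forall>\<alpha>\<ge>1. \<forall>r\<in>{0<..R}.
        condition_K \<alpha> K b (\<lambda>n. measure lborel (erosion (W n) (2 * R))) \<longrightarrow>
        (\<exists>\<delta>>0. bounded_continuous_deriv \<alpha> (\<lambda>t. exp (- \<gamma> t) * J_fun M X R t) {r - \<delta><..<r + \<delta>}) \<longrightarrow>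
        (\<lambda>n. (\<integral>\<omega>. R_hat K R (b n) (W n) r (X \<omega>) \<partial>M) - \<beta>\<^sup>2 * J_fun M X R r * exp (- \<gamma> r))
          \<in> O(\<lambda>n. b n ^ \<alpha>))"
proof -
  interpret pairwise_interaction_process M X \<beta> R \<gamma>
    using process intensity params gamma_pos gamma_range by unfold_locales auto
  define A where "A r n = 1 / b n * (\<integral>t. K ((t - r) / b n) * (indicator {0<..R} t * f t) \<partial>lborel)" for r n
  \<comment> \<open>The order and the volume sequence stay arbitrary here because only the sign and
    measurability facts of the condition enter; both parts of the theorem then share this identity,
    in which the window no longer appears.\<close>
  have expectation: "(\<integral>\<omega>. R_hat K R (b n) (W n) r (X \<omega>) \<partial>M) = \<beta>\<^sup>2 * A r n"
    if "condition_K \<alpha> K b w" for \<alpha> w r n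
  proof -
    have "compact (W n)" using windows(1)[of n] by (auto simp: is_cube_def)
    with that windows(4)[of n] show ?thesis
      by (subst integral_R_hat) (auto simp: condition_K_def A_def)
  qed
  show ?thesis
  proof (intro conjI impI allI ballI)
    fix r assume cond: "condition_K 1 K b (\<lambda>n. measure lborel (erosion (W n) (2 * R)))"
      and r: "r \<in> {0<..R}" "isCont \<gamma> r"
    obtain c where "0 < c" "smoothing_kernel K c" using condition_K_kernel[OF cond] .
    then have "A r \<longlonglongrightarrow> f r"
      unfolding A_def using cond r by (intro truncated_f_tendsto) (auto simp: condition_K_def)
    then have "(\<lambda>n. \<beta>\<^sup>2 * A r n) \<longlonglongrightarrow> \<beta>\<^sup>2 * f r" by (rule tendsto_mult_left)
    then show "(\<lambda>n. \<integral>\<omega>. R_hat K R (b n) (W n) r (X \<omega>) \<partial>M) \<longlonglongrightarrow> \<beta>\<^sup>2 * J r * exp (- \<gamma> r)"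
      by (simp add: expectation[OF cond] mult_ac)
  next
    fix \<alpha> :: nat and r
    assume \<alpha>: "1 \<le> \<alpha>" and r: "r \<in> {0<..R}"
      and cond: "condition_K \<alpha> K b (\<lambda>n. measure lborel (erosion (W n) (2 * R)))"
      and "\<exists>\<delta>>0. bounded_continuous_deriv \<alpha> f {r - \<delta><..<r + \<delta>}"
    then obtain \<delta> where \<delta>: "0 < \<delta>" "bounded_continuous_deriv \<alpha> f {r - \<delta><..<r + \<delta>}" by auto
    obtain c where c: "0 < c" "smoothing_kernel K c" using condition_K_kernel[OF cond] .
    have b: "\<And>n. 0 < b n" "b \<longlonglongrightarrow> 0"
      and moments: "\<And>j. j \<in> {1..<\<alpha>} \<Longrightarrow> (\<integral>s. s ^ j * K s \<partial>lborel) = 0"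
      using cond by (auto simp: condition_K_def)
    obtain C \<eta> where C: "0 < \<eta>" "0 \<le> C"
      "\<And>b. 0 < b \<Longrightarrow> b * c < \<eta> \<Longrightarrow>
        \<bar>1 / b * (\<integral>t. K ((t - r) / b) * (indicator {0<..R} t * f t) \<partial>lborel) - f r\<bar> \<le> C * (b * c) ^ \<alpha>"
      using truncated_f_error[OF c(2) \<alpha> moments r \<delta>] by auto
    \<comment> \<open>From some index on, the scaled support radius \<open>b n * c\<close> is below
      \<open>\<eta>\<close>; its power contributes the factor \<open>c ^ \<alpha>\<close> to the
      constant of the O-bound.\<close>
    have "eventually (\<lambda>n. b n < \<eta> / c) sequentially"
      using b(2) C(1) c(1) by (intro order_tendstoD(2)[of b 0]) auto
    then have "eventually (\<lambda>n. norm ((\<integral>\<omega>. R_hat K R (b n) (W n) r (X \<omega>) \<partial>M) - \<beta>\<^sup>2 * J r * exp (- \<gamma> r))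
        \<le> (\<beta>\<^sup>2 * C * c ^ \<alpha>) * norm (b n ^ \<alpha>)) sequentially"
    proof eventually_elim
      fix n assume "b n < \<eta> / c"
      then have "\<bar>A r n - f r\<bar> \<le> C * (b n * c) ^ \<alpha>"
        unfolding A_def using c(1) b(1) by (intro C(3)) (auto simp: field_simps)
      then have "\<beta>\<^sup>2 * \<bar>A r n - f r\<bar> \<le> \<beta>\<^sup>2 * (C * (b n * c) ^ \<alpha>)" by (intro mult_left_mono) auto
      moreover have "(\<integral>\<omega>. R_hat K R (b n) (W n) r (X \<omega>) \<partial>M) - \<beta>\<^sup>2 * J r * exp (- \<gamma> r) = \<beta>\<^sup>2 * (A r n - f r)"
        by (simp add: expectation[OF cond] algebra_simps)
      ultimately show "norm ((\<integral>\<omega>. R_hat K R (b n) (W n) r (X \<omega>) \<partial>M) - \<beta>\<^sup>2 * J r * exp (- \<gamma> r))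
          \<le> (\<beta>\<^sup>2 * C * c ^ \<alpha>) * norm (b n ^ \<alpha>)"
        using b(1)[of n] by (simp add: abs_mult power_mult_distrib mult_ac)
    qed
    then show "(\<lambda>n. (\<integral>\<omega>. R_hat K R (b n) (W n) r (X \<omega>) \<partial>M) - \<beta>\<^sup>2 * J r * exp (- \<gamma> r)) \<in> O(\<lambda>n. b n ^ \<alpha>)"
      by (rule bigoI)
  qed
qed

end
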